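(* Let $X$ be a Polish space and let $(w_n)$ be a sequence converging to $w$ in $\mathcal W(X)$. Then (i) Up to $\sim$ identification, if $w_n=(a_n,\mu_n)$ and $(a_n)$ is bounded, then $a_n\to a$, $\mu_n\to\mu$ in $\mathcal P(X)$, and $w=(a,\mu)\in\mathcal U(X)$. (ii) If $w_n=(a_n,\mu_n)$ and $a_n\to+\infty$, then $w=I\in\mathcal V(X)$ and $(\mu_n)$ satisfies a weak large deviations principle with speed $(a_n)$ and rate $I$. (iii) If $w_n=I_n\in\mathcal V(X)$, then $w=I\in\mathcal V(X)$ and $I_n$ $\Gamma$-converges to $I$. The relative topology induced by $\mathcal W(X)$ on an equicoercive subset $\mathcal E\subset\mathcal W(X)$ is metrizable.
   Context: $\mathcal P(X)$ is the space of Borel probability measures on $X$ with the narrow (weak) topology. $\mathfrak K(X)$ is the collection of compact subsets of $X$ with the Hausdorff topology, i.e. the topology of the distance $d_H(K,K')=\inf\{\varepsilon>0: K\subset K'^{\varepsilon},\ K'\subset K^{\varepsilon}\}$, where $A^\varepsilon$ is the $\varepsilon$-enlargement of $A$ for a fixed compatible distance on $X$. For $a>0$ and $\mu\in\mathcal P(X)$, and for $I\colon X\to[0,+\infty]$ lower semicontinuous, define $l_{a,\mu},l_I\colon\mathfrak K(X)\to[0,+\infty]$ by $l_{a,\mu}(K)=-\frac1a\log\mu(K)$ and $l_I(K)=\inf_{x\in K}I(x)$ (with $-\log0=+\infty$). On pairs $(a,\mu)$ with $a\in\mathbb R^+$ (here strictly positive reals) and $\mu\in\mathcal P(X)$, let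 $(a,\mu)\sim(a',\mu')$ iff either $(a,\mu)=(a',\mu')$ or there is $x\in X$ with $\mu=\mu'=\delta_x$; equivalently iff $l_{a,\mu}=l_{a',\mu'}$. Set - $\mathcal U(X)=(\mathbb R^+\times\mathcal P(X))/\sim$, - $\mathcal V(X)=\{I\colon X\to[0,+\infty]: I\text{ lower semicontinuous}\}$, - $\mathcal W(X)=\mathcal U(X)\cup\mathcal V(X)$, - $\mathcal L(X)=\{l\colon\mathfrak K(X)\to[0,+\infty]: l\text{ lower semicontinuous, and } l(K)\le l(K')\text{ if }K\supset K'\}$. $\mathcal L(X)$ is equipped with the topology of $\Gamma$-convergence on $\mathfrak K(X)$ (in the sense of Dal Maso, An introduction to $\Gamma$-convergence, Chapter 10), i.e. the topology generated by the sets $\{l:\inf_{U}l<t\}$ and $\{l:\inf_{C}l>t\}$, for $U\subset\mathfrak K(X)$ open, $C\subset\mathfrak K(X)$ compact, $t\in\mathbb R$. The maps $(a,\mu)\mapsto l_{a,\mu}$ and $I\mapsto l_I$ define the embedding $\mathcal W(X)\hookrightarrow\mathcal L(X)$ (elements with the same image being identified), and $\mathcal W(X)$ carries the induced topology. A subset of $\mathcal W(X)$ is equicoercive if its image $E$ in $\mathcal L(X)$ is equicoercive, i.e. for each $\ell>0$ the set $\bigcup_{l\in E}\{K\in\mathfrak K(X): l(K)\le\ell\}$ is precompact in $\mathfrak K(X)$. $(\mu_n)$ satisfies a weak large deviations principle with speed $(a_n)$ and rate $I$ iff $\varliminf_n\frac1{a_n}\log\mu_n(O)\ge-\inf_OI$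 for each open $O\subset X$ and $\varlimsup_n\frac1{a_n}\log\mu_n(K)\le-\inf_KI$ for each compact $K\subset X$. $I_n$ $\Gamma$-converges to $I$ on $X$ iff for every $x\in X$ one has $I(x)=\inf\{\varliminf_nI_n(x_n)\}=\inf\{\varlimsup_nI_n(x_n)\}$, both infima being over sequences $x_n\to x$ in $X$.
   Formalization: In (i) the hypothesis inf_K w(K) = 0 is added (it holds whenever w is in U(X); without it (i) fails, e.g. X = N, a_n = 1, mu_n = (delta_0+delta_n)/2), and a_n -> a is asserted only when the limit mu is not a Dirac mass. *)

theory Defs
  imports "HOL-Probability.Probability"
begin

typedef (overloaded) 'a compacts = "{K :: 'a::topological_space set. compact K}"
  morphisms carrier_of Compacts
  by (rule exI[of _ "{}"]) simp

definition enlargement :: "real \<Rightarrow> 'a::metric_space set \<Rightarrow> 'a set" where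
  "enlargement \<epsilon> A = (\<Union>y\<in>A. ball y \<epsilon>)"

text \<open>The distance is extended-real valued because the empty set is a compact set: it lies at
  distance \<open>\<infinity>\<close> from every other one and hence is an isolated point.\<close>

definition hausdorff_distance :: "'a::metric_space compacts \<Rightarrow> 'a compacts \<Rightarrow> ereal" where
  "hausdorff_distance K K' =
     Inf {ereal \<epsilon> | \<epsilon>. 0 < \<epsilon> \<and> carrier_of K \<subseteq> enlargement \<epsilon> (carrier_of K') \<and>
                          carrier_of K' \<subseteq> enlargement \<epsilon> (carrier_of K)}"

instantiation compacts :: (metric_space) topological_space
begin

definition open_compacts :: "'a compacts set \<Rightarrow> bool" where
  "open_compacts U \<longleftrightarrow>
     (\<forall>K\<in>U. \<exists>\<epsilon>>0. \<forall>K'. hausdorff_distance K K' < ereal \<epsilon> \<longrightarrow> K' \<in> U)"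

instance
proof
  show "open (UNIV :: 'a compacts set)"
    unfolding open_compacts_def by (auto intro: exI[of _ 1])
next
  fix S T :: "'a compacts set"
  assume S: "open S" and T: "open T"
  show "open (S \<inter> T)"
    unfolding open_compacts_def
  proof
    fix K assume "K \<in> S \<inter> T"
    then have "K \<in> S" "K \<in> T" by auto
    obtain d where "d > 0" and d: "\<And>K'. hausdorff_distance K K' < ereal d \<Longrightarrow> K' \<in> S"
      using S \<open>K \<in> S\<close> unfolding open_compacts_def by blast
    obtain e where "e > 0" and e: "\<And>K'. hausdorff_distance K K' < ereal e \<Longrightarrow> K' \<in> T"
      using T \<open>K \<in> T\<close> unfolding open_compacts_def by blast
    have "K' \<in> S \<inter> T" if "hausdorff_distance K K' < ereal (min d e)" for K'
    proof -
      have "ereal (min d e) \<le> ereal d" "ereal (min d e) \<le> ereal e" by simp_all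
      then show ?thesis
        using d[of K'] e[of K'] less_le_trans[OF that] by blast
    qed
    moreover have "min d e > 0" using \<open>d > 0\<close> \<open>e > 0\<close> by simp
    ultimately show "\<exists>\<epsilon>>0. \<forall>K'. hausdorff_distance K K' < ereal \<epsilon> \<longrightarrow> K' \<in> S \<inter> T"
      by blast
  qed
next
  fix \<K> :: "'a compacts set set"
  assume opn: "\<forall>S\<in>\<K>. open S"
  show "open (\<Union>\<K>)"
    unfolding open_compacts_def
  proof
    fix K assume "K \<in> \<Union>\<K>"
    then obtain S where "S \<in> \<K>" "K \<in> S" by blast
    then obtain \<epsilon> where "\<epsilon> > 0" "\<forall>K'. hausdorff_distance K K' < ereal \<epsilon> \<longrightarrow> K' \<in> S"
      using opn unfolding open_compacts_def by blast
    with \<open>S \<in> \<K>\<close> show "\<exists>\<epsilon>>0. \<forall>K'. hausdorff_distance K K' < ereal \<epsilon> \<longrightarrow> K' \<in> \<Union>\<K>"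
      by blast
  qed
qed

end

definition prob_measures :: "'a::topological_space measure set" where
  "prob_measures = {\<mu>. prob_space \<mu> \<and> sets \<mu> = sets borel}"

definition narrow_topology :: "'a::topological_space measure topology" where
  "narrow_topology = topology_generated_by
     {{\<mu> \<in> prob_measures. (\<integral>x. f x \<partial>\<mu>) \<in> V} | (f :: 'a \<Rightarrow> real) V.
        continuous_on UNIV f \<and> bounded (range f) \<and> open V}"

definition lower_semicont :: "('b::topological_space \<Rightarrow> ereal) \<Rightarrow> bool" where
  "lower_semicont f \<longleftrightarrow> (\<forall>t. open {x. t < f x})"

definition L_space :: "('a::metric_space compacts \<Rightarrow> ereal) set" where
  "L_space = {l. (\<forall>K. 0 \<le> l K) \<and> lower_semicont l \<and>
                 (\<forall>K K'. carrier_of K' \<subseteq> carrier_of K \<longrightarrow> l K \<le> l K')}"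

definition L_topology :: "('a::metric_space compacts \<Rightarrow> ereal) topology" where
  "L_topology = topology_generated_by
     ({{l \<in> L_space. (INF K\<in>U. l K) < ereal t} | U t. open U} \<union>
      {{l \<in> L_space. (INF K\<in>C. l K) > ereal t} | C t. compact C})"

definition elog :: "real \<Rightarrow> ereal" where
  "elog p = (if p = 0 then - \<infinity> else ereal (ln p))"

definition l_meas :: "real \<Rightarrow> 'a::topological_space measure \<Rightarrow> 'a compacts \<Rightarrow> ereal" where
  "l_meas a \<mu> K = - (ereal (1 / a) * elog (measure \<mu> (carrier_of K)))"

definition l_rate :: "('a::topological_space \<Rightarrow> ereal) \<Rightarrow> 'a compacts \<Rightarrow> ereal" where
  "l_rate I K = (INF x\<in>carrier_of K. I x)"

definition rate_functions :: "('a::topological_space \<Rightarrow> ereal) set" where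
  "rate_functions = {I. (\<forall>x. 0 \<le> I x) \<and> lower_semicont I}"

text \<open>Elements of \<open>\<U>(X)\<close>, \<open>\<V>(X)\<close> and \<open>\<W>(X)\<close> are represented by their images in
  \<open>\<L>(X)\<close>. This performs the identifications: \<open>(a, \<mu>) \<sim> (a', \<mu>')\<close> holds exactly when both pairs
  have the same image, and a class \<open>(a, \<delta>\<^sub>x)\<close> is identified with the function that
  vanishes at \<open>x\<close> and is infinite elsewhere.\<close>

definition U_space :: "('a::metric_space compacts \<Rightarrow> ereal) set" where
  "U_space = {l_meas a \<mu> | a \<mu>. 0 < a \<and> \<mu> \<in> prob_measures}"

definition V_space :: "('a::metric_space compacts \<Rightarrow> ereal) set" where
  "V_space = l_rate ` rate_functions"

definition W_space :: "('a::metric_space compacts \<Rightarrow> ereal) set" where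
  "W_space = U_space \<union> V_space"

definition W_topology :: "('a::metric_space compacts \<Rightarrow> ereal) topology" where
  "W_topology = subtopology L_topology W_space"

definition equicoercive :: "('a::metric_space compacts \<Rightarrow> ereal) set \<Rightarrow> bool" where
  "equicoercive E \<longleftrightarrow> (\<forall>r::real. 0 < r \<longrightarrow> compact (closure (\<Union>l\<in>E. {K. l K \<le> ereal r})))"

definition weak_LDP ::
  "(nat \<Rightarrow> real) \<Rightarrow> (nat \<Rightarrow> 'a::topological_space measure) \<Rightarrow> ('a \<Rightarrow> ereal) \<Rightarrow> bool" where
  "weak_LDP a \<mu> I \<longleftrightarrow>
     (\<forall>G. open G \<longrightarrow> liminf (\<lambda>n. ereal (1 / a n) * elog (measure (\<mu> n) G)) \<ge> - (INF x\<in>G. I x)) \<and>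
     (\<forall>K. compact K \<longrightarrow> limsup (\<lambda>n. ereal (1 / a n) * elog (measure (\<mu> n) K)) \<le> - (INF x\<in>K. I x))"

definition gamma_converges ::
  "(nat \<Rightarrow> 'a::topological_space \<Rightarrow> ereal) \<Rightarrow> ('a \<Rightarrow> ereal) \<Rightarrow> bool" where
  "gamma_converges F I \<longleftrightarrow>
     (\<forall>x. I x = Inf {liminf (\<lambda>n. F n (y n)) | y. y \<longlonglongrightarrow> x} \<and>
          I x = Inf {limsup (\<lambda>n. F n (y n)) | y. y \<longlonglongrightarrow> x})"

end

theory Submission
  imports Defs
begin

text \<open>
  Write \<open>l(G)\<close>, for \<open>G\<close> open in \<open>X\<close>, for the infimum of \<open>l\<close> over the compact subsets of \<open>G\<close>.
  Because the elements of \<open>\<L>(X)\<close> are decreasing in \<open>K\<close> and lower semicontinuous, convergence in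
  \<open>\<L>(X)\<close> can be used on \<open>X\<close> itself: if \<open>w\<^sub>n\<close> tends to \<open>l\<close>, then \<open>l(K) > t\<close> forces \<open>w\<^sub>n(K) > t\<close>
  eventually for each fixed compact \<open>K\<close> (\<open>limitin_L_liminf\<close>), while \<open>l(K) < t\<close> and \<open>K \<subseteq> G\<close> yield one
  compact set \<open>Q \<subseteq> G\<close> with \<open>w\<^sub>n(Q) < t\<close> eventually (\<open>limitin_L_recovery_compact\<close>). That \<open>Q\<close> is
  compact replaces local compactness of \<open>X\<close> throughout: the recovery sequence shrinks to \<open>K\<close>, and its
  union with \<open>K\<close> is compact.

  An element of \<open>\<L>(X)\<close> that is infinite on the empty set is \<open>l_rate I\<close> for some rate function \<open>I\<close>
  as soon as \<open>l(A \<union> B) \<ge> min (l A) (l B)\<close> (\<open>maxitive_imp_l_rate\<close>). This inequality holds for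
  \<open>l_rate J\<close>, holds for \<open>l_meas a \<mu>\<close> up to \<open>ln 2 / a\<close>, and passes to limits
  (\<open>maxitive_limit\<close>). So when \<open>a\<^sub>n \<rightarrow> \<infinity>\<close>, or when all \<open>w\<^sub>n\<close> are rate functions, the limit
  is a rate function, and the two facts above are the bounds in the weak large deviations principle
  and in \<open>\<Gamma>\<close>-convergence.

  Let now \<open>a\<^sub>n\<close> be bounded. If the limit is \<open>l_meas b \<nu>\<close> and \<open>a\<^sub>n \<rightarrow> \<alpha>\<close> along a subsequence,
  then with \<open>c = \<alpha> / b\<close> one gets \<open>liminf \<mu>\<^sub>n(G) \<ge> \<nu>(G)\<^sup>c\<close> for open \<open>G\<close>. The \<open>\<mu>\<^sub>n\<close> are also tight,
  so that \<open>limsup \<mu>\<^sub>n(F) \<le> \<nu>(F)\<^sup>c\<close> for closed \<open>F\<close> if \<open>\<alpha> > 0\<close>. By inner regularity of \<open>\<nu>\<close>, these two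
  bounds applied to a Borel set of mass \<open>p\<close> and to its complement are incompatible with
  \<open>p\<^sup>c + (1 - p)\<^sup>c \<noteq> 1\<close>, hence either \<open>c = 1\<close> or \<open>\<nu>\<close> only takes the values 0 and 1 and is a Dirac mass.
  In both cases \<open>\<nu>\<^sup>c = \<nu>\<close>, and the bound on open sets is narrow convergence to \<open>\<nu>\<close>. If the limit
  is \<open>l_rate I\<close> with infimum 0, mass close to 1 sits near every point where \<open>I\<close> is small, so there is
  only one such point, and the limit is again the image of a Dirac mass. Prokhorov's theorem
  is avoided because the limit is known to lie in \<open>\<W>(X)\<close>.

  Metrizability is quick to reduce to a compact \<open>X\<close>: if \<open>l(K) \<le> r\<close>, then all the sets
  \<open>K \<union> {x}\<close> lie in one precompact family, whose union is \<open>X\<close>; so an equicoercive set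
  either consists of the function \<open>\<infinity>\<close> alone or forces \<open>X\<close> to be compact. For compact \<open>X\<close>, the
  whole of \<open>\<L>(X)\<close> is metrizable. The enlargements of a finite set \<open>F\<close> make \<open>l\<close> decrease, and the
  radius at which this decreasing function crosses the line \<open>t + r\<close> depends continuously on \<open>l\<close>; countably many
  such radii embed \<open>\<L>(X)\<close> into a countable product of lines (\<open>metrizable_L_topology\<close>).\<close>

section \<open>Compact sets and the Hausdorff topology\<close>

lemma compact_carrier_of [simp]: "compact (carrier_of K)"
  using carrier_of[of K] by simp

lemma carrier_of_Compacts [simp]: "compact A \<Longrightarrow> carrier_of (Compacts A) = A"
  by (simp add: Compacts_inverse)

lemma hausdorff_distance_less_imp_subset:
  assumes "hausdorff_distance K K' < ereal \<epsilon>"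
  shows "carrier_of K' \<subseteq> enlargement \<epsilon> (carrier_of K)"
proof -
  obtain d where "d < \<epsilon>" "carrier_of K' \<subseteq> enlargement d (carrier_of K)"
    using assms by (auto simp: hausdorff_distance_def Inf_less_iff)
  then show ?thesis by (force simp: enlargement_def)
qed

lemma hausdorff_distance_lessI:
  assumes "0 < d" "d < \<epsilon>" "carrier_of K \<subseteq> enlargement d (carrier_of K')"
    "carrier_of K' \<subseteq> enlargement d (carrier_of K)"
  shows "hausdorff_distance K K' < ereal \<epsilon>"
proof -
  have "hausdorff_distance K K' \<le> ereal d"
    unfolding hausdorff_distance_def using assms by (intro Inf_lower) auto
  also have "\<dots> < ereal \<epsilon>" using assms by simp
  finally show ?thesis .
qed

lemma enlargement_facts:
  shows open_enlargement: "open (enlargement \<epsilon> A)"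
    and subset_enlargement: "0 < \<epsilon> \<Longrightarrow> A \<subseteq> enlargement \<epsilon> A"
    and enlargement_mono: "\<epsilon> \<le> \<epsilon>' \<Longrightarrow> enlargement \<epsilon> A \<subseteq> enlargement \<epsilon>' A"
  unfolding enlargement_def by (blast, force, force)

lemma compact_enlargement_subset:
  assumes "compact K" "open G" "K \<subseteq> G"
  obtains \<epsilon> where "0 < \<epsilon>" "enlargement \<epsilon> K \<subseteq> G"
  using compact_subset_open_imp_ball_epsilon_subset[OF assms] unfolding enlargement_def by metis

lemma open_compacts_inside:
  assumes "open G"
  shows "open {K. carrier_of K \<subseteq> G}"
  unfolding open_compacts_def
proof
  fix K assume "K \<in> {K. carrier_of K \<subseteq> G}"
  then have "carrier_of K \<subseteq> G" by simp
  then obtain \<epsilon> where "0 < \<epsilon>" "enlargement \<epsilon> (carrier_of K) \<subseteq> G"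
    using compact_enlargement_subset[OF compact_carrier_of assms] by metis
  then show "\<exists>\<epsilon>>0. \<forall>K'. hausdorff_distance K K' < ereal \<epsilon> \<longrightarrow> K' \<in> {K. carrier_of K \<subseteq> G}"
    using hausdorff_distance_less_imp_subset by blast
qed

text \<open>Open covers do the job: the compact sets covered by a fixed finite family of open sets form an
  open subset of the hyperspace.\<close>
lemma compact_Union_carrier:
  assumes "compact C"
  shows "compact (\<Union>K\<in>C. carrier_of K)"
proof (rule topological_space_class.compactI)
  fix \<U> assume op: "\<forall>U\<in>\<U>. open U" and cov: "(\<Union>K\<in>C. carrier_of K) \<subseteq> \<Union>\<U>"
  have "\<exists>\<D>. \<D> \<subseteq> \<U> \<and> finite \<D> \<and> carrier_of K \<subseteq> \<Union>\<D>" if "K \<in> C" for K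
    using compactE[of "carrier_of K" \<U>] that op cov by (smt (verit) UN_subset_iff compact_carrier_of)
  then obtain D where D: "\<And>K. K \<in> C \<Longrightarrow> D K \<subseteq> \<U> \<and> finite (D K) \<and> carrier_of K \<subseteq> \<Union>(D K)"
    by metis
  have "open {K'. carrier_of K' \<subseteq> \<Union>(D K)}" if "K \<in> C" for K
    using D[OF that] op by (intro open_compacts_inside open_Union) blast
  then obtain C' where C': "C' \<subseteq> C" "finite C'" "C \<subseteq> (\<Union>K\<in>C'. {K'. carrier_of K' \<subseteq> \<Union>(D K)})"
  proof (rule compactE_image[OF assms, of C "\<lambda>K. {K'. carrier_of K' \<subseteq> \<Union>(D K)}"])
    show "C \<subseteq> (\<Union>K\<in>C. {K'. carrier_of K' \<subseteq> \<Union>(D K)})"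
      using D by (intro subsetI UN_I) auto
  qed
  show "\<exists>\<U>'\<subseteq>\<U>. finite \<U>' \<and> (\<Union>K\<in>C. carrier_of K) \<subseteq> \<Union>\<U>'"
  proof (intro exI[of _ "\<Union>K\<in>C'. D K"] conjI)
    show "(\<Union>K\<in>C'. D K) \<subseteq> \<U>"
      using D subsetD[OF C'(1)] by (intro UN_least) simp
    show "finite (\<Union>K\<in>C'. D K)"
      using C'(2) D subsetD[OF C'(1)] by (intro finite_UN_I) simp_all
    show "(\<Union>K\<in>C. carrier_of K) \<subseteq> \<Union>(\<Union>K\<in>C'. D K)"
    proof (rule UN_least)
      fix K assume "K \<in> C"
      then obtain K' where "K' \<in> C'" "carrier_of K \<subseteq> \<Union>(D K')" using C'(3) by auto
      then show "carrier_of K \<subseteq> \<Union>(\<Union>K\<in>C'. D K)" by blast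
    qed
  qed
qed

text \<open>The parts of \<open>Q\<close> outside \<open>U\<close> and outside \<open>V\<close> are disjoint and compact, and cutting away
  disjoint neighbourhoods of them leaves the two pieces. This is the device for splitting a
  compact set along an open cover while staying with compact sets.\<close>
lemma compact_cover_split:
  fixes Q :: "'a::metric_space set"
  assumes "compact Q" "open U" "open V" "Q \<subseteq> U \<union> V"
  obtains A B where "compact A" "compact B" "A \<subseteq> U" "B \<subseteq> V" "Q = A \<union> B"
proof -
  have "compact (Q - U)" "compact (Q - V)" "(Q - U) \<inter> (Q - V) = {}"
    using assms by (auto intro: compact_diff)
  then obtain U' V' where *: "open U'" "open V'" "Q - U \<subseteq> U'" "Q - V \<subseteq> V'" "U' \<inter> V' = {}"
    by (meson compact_imp_closed t4_space)
  show ?thesis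
    by (rule that[of "Q - U'" "Q - V'"]) (use * assms in \<open>auto intro: compact_diff\<close>)
qed

text \<open>Finitely many open sets that cover \<open>K\<close> cover all but finitely many \<open>L n\<close>.\<close>
lemma compact_Un_shrinking:
  assumes K: "compact K" and L: "\<And>n. compact (L n)"
    and shrink: "\<And>G. open G \<Longrightarrow> K \<subseteq> G \<Longrightarrow> eventually (\<lambda>n. L n \<subseteq> G) sequentially"
  shows "compact (K \<union> (\<Union>n\<in>{N..}. L n))"
proof (rule topological_space_class.compactI)
  fix \<U> assume op: "\<forall>U\<in>\<U>. open U" and cov: "K \<union> (\<Union>n\<in>{N..}. L n) \<subseteq> \<Union>\<U>"
  obtain D where D: "D \<subseteq> \<U>" "finite D" "K \<subseteq> \<Union>D"
    by (rule compactE[OF K, of \<U>]) (use op cov in auto)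
  have "open (\<Union>D)" using D op by blast
  then obtain M where M: "\<And>n. n \<ge> M \<Longrightarrow> L n \<subseteq> \<Union>D"
    using shrink D(3) by (metis eventually_sequentially)
  have "compact (\<Union>n\<in>{N..<M}. L n)" using L by blast
  moreover have "(\<Union>n\<in>{N..<M}. L n) \<subseteq> \<Union>\<U>" using cov by fastforce
  ultimately obtain D' where D': "D' \<subseteq> \<U>" "finite D'" "(\<Union>n\<in>{N..<M}. L n) \<subseteq> \<Union>D'"
    by (rule compactE) (use op in auto)
  have "L n \<subseteq> \<Union>(D \<union> D')" if "n \<ge> N" for n
  proof (cases "n < M")
    case True
    then have "L n \<subseteq> (\<Union>n\<in>{N..<M}. L n)" using that by (intro UN_upper) simp
    with D' show ?thesis by blast
  qed (use M[of n] in auto)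
  then show "\<exists>\<U>'\<subseteq>\<U>. finite \<U>' \<and> K \<union> (\<Union>n\<in>{N..}. L n) \<subseteq> \<Union>\<U>'"
    using D D' by (intro exI[of _ "D \<union> D'"]) auto
qed

section \<open>The Gamma-topology in terms of compact and open sets\<close>

lemma L_space_antimono:
  "l \<in> L_space \<Longrightarrow> carrier_of K' \<subseteq> carrier_of K \<Longrightarrow> l K \<le> l K'"
  by (auto simp: L_space_def)

lemma L_space_nonneg: "l \<in> L_space \<Longrightarrow> 0 \<le> l K"
  by (auto simp: L_space_def)

text \<open>The Hausdorff neighbourhood of \<open>K\<close> given by lower semicontinuity contains \<open>P \<union> K\<close> for
  every compact \<open>P\<close> close to \<open>K\<close>, and passing from \<open>P \<union> K\<close> to \<open>P\<close> only increases \<open>l\<close>; so \<open>P\<close>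
  may be a small part of the neighbourhood of \<open>K\<close>.\<close>
lemma L_space_outer:
  assumes l: "l \<in> L_space" and t: "t < l K"
  obtains G where "open G" "carrier_of K \<subseteq> G" "\<And>P. carrier_of P \<subseteq> G \<Longrightarrow> t < l P"
proof -
  have "open {K. t < l K}" using l by (auto simp: L_space_def lower_semicont_def)
  then obtain \<epsilon> where e: "0 < \<epsilon>" and *: "\<And>K'. hausdorff_distance K K' < ereal \<epsilon> \<Longrightarrow> t < l K'"
    using t unfolding open_compacts_def by blast
  let ?G = "enlargement (\<epsilon> / 2) (carrier_of K)"
  have KG: "carrier_of K \<subseteq> ?G" using e by (simp add: subset_enlargement)
  have "t < l P" if P: "carrier_of P \<subseteq> ?G" for P
  proof -
    define K' where "K' = Compacts (carrier_of P \<union> carrier_of K)"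
    have K': "carrier_of K' = carrier_of P \<union> carrier_of K" by (simp add: K'_def compact_Un)
    have "hausdorff_distance K K' < ereal \<epsilon>"
    proof (rule hausdorff_distance_lessI[of "\<epsilon> / 2"])
      show "carrier_of K \<subseteq> enlargement (\<epsilon> / 2) (carrier_of K')"
        using subset_enlargement[of "\<epsilon> / 2" "carrier_of K'"] e K' by auto
      show "carrier_of K' \<subseteq> ?G" using P KG K' by auto
    qed (use e in auto)
    then have "t < l K'" by (rule *)
    also have "\<dots> \<le> l P" using L_space_antimono[OF l] K' by auto
    finally show ?thesis .
  qed
  with KG show ?thesis using that[OF open_enlargement] by blast
qed

lemma topspace_L_topology: "topspace L_topology \<subseteq> L_space"
  by (auto simp: L_topology_def)

lemma openin_L_topology_above:
  "openin L_topology {l \<in> L_space. ereal t < l K}"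
proof -
  have "openin L_topology {l \<in> L_space. (INF K\<in>{K}. l K) > ereal t}"
    unfolding L_topology_def by (rule topology_generated_by_Basis) (blast intro: compact_insert compact_empty)
  then show ?thesis by simp
qed

lemma openin_L_topology_below:
  assumes "open G"
  shows "openin L_topology {l \<in> L_space. \<exists>K. carrier_of K \<subseteq> G \<and> l K < ereal t}"
proof -
  have "openin L_topology {l \<in> L_space. (INF K\<in>{K. carrier_of K \<subseteq> G}. l K) < ereal t}"
    unfolding L_topology_def using open_compacts_inside[OF assms]
    by (intro topology_generated_by_Basis) blast
  then show ?thesis by (simp add: INF_less_iff)
qed

lemma topspace_L_topology_eq: "topspace L_topology = (L_space :: ('a::metric_space compacts \<Rightarrow> ereal) set)"
proof
  let ?e = "Compacts {} :: 'a compacts"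
  have "openin L_topology {l \<in> L_space. ereal (-1) < l ?e}" by (rule openin_L_topology_above)
  moreover have "{l \<in> L_space. ereal (-1) < l ?e} = L_space"
    using L_space_nonneg less_le_trans[of "ereal (-1)" 0] by fastforce
  ultimately show "(L_space :: ('a compacts \<Rightarrow> ereal) set) \<subseteq> topspace L_topology"
    using openin_subset by metis
qed (rule topspace_L_topology)

lemma limitin_L_imp:
  assumes "limitin L_topology w l sequentially"
  shows limitin_L_in_L_space: "l \<in> L_space"
    and limitin_L_eventually_in_L_space: "eventually (\<lambda>n. w n \<in> L_space) sequentially"
  using assms openin_topspace[of L_topology] unfolding limitin_def topspace_L_topology_eq by blast+

lemma limitin_L_liminf:
  assumes "limitin L_topology w l sequentially" "t < l K"
  shows "eventually (\<lambda>n. t < w n K) sequentially"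
proof -
  obtain r where r: "t < ereal r" "ereal r < l K" using assms(2) ereal_dense2 by blast
  have "eventually (\<lambda>n. w n \<in> {l \<in> L_space. ereal r < l K}) sequentially"
    using assms r limitin_L_in_L_space[OF assms(1)] openin_L_topology_above unfolding limitin_def by blast
  then show ?thesis
    by eventually_elim (use r in auto)
qed

text \<open>Take for \<open>m n\<close> the largest \<open>k \<le> n\<close> such that \<open>P k\<close> is known to hold from \<open>n\<close> on.\<close>
lemma diagonal_sequence:
  fixes P :: "nat \<Rightarrow> nat \<Rightarrow> bool"
  assumes "\<And>k. eventually (P k) sequentially"
  obtains m where "filterlim m at_top sequentially" "eventually (\<lambda>n. P (m n) n) sequentially"
proof -
  obtain N where N: "\<And>k n. n \<ge> N k \<Longrightarrow> P k n"
    using assms unfolding eventually_sequentially by metis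
  define m where "m n = Max ({0} \<union> {k. k \<le> n \<and> N k \<le> n})" for n
  have fin: "finite ({0} \<union> {k. k \<le> n \<and> N k \<le> n})" for n by auto
  have "k \<le> m n" if "n \<ge> max k (N k)" for k n
    unfolding m_def using that by (intro Max_ge fin) auto
  then have "filterlim m at_top sequentially"
    unfolding filterlim_at_top eventually_sequentially by blast
  moreover have "P (m n) n" if "n \<ge> N 0" for n
  proof -
    have "m n \<in> {0} \<union> {k. k \<le> n \<and> N k \<le> n}"
      unfolding m_def by (intro Max_in fin) auto
    then show ?thesis using N that by auto
  qed
  ultimately show ?thesis using that eventually_sequentially by blast
qed

text \<open>The upper bound of \<open>\<Gamma>\<close>-convergence. It concerns sets that stay inside small neighbourhoods
  of \<open>K\<close> but need not approach all of \<open>K\<close>, which is enough since adding \<open>K\<close> only decreases the functionals.\<close>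
lemma limitin_L_recovery_sequence:
  assumes lim: "limitin L_topology w l sequentially" and t: "l K < t"
  obtains L where "eventually (\<lambda>n. w n (L n) < t) sequentially"
    "\<And>G. open G \<Longrightarrow> carrier_of K \<subseteq> G \<Longrightarrow> eventually (\<lambda>n. carrier_of (L n) \<subseteq> G) sequentially"
proof -
  obtain r where r: "l K < ereal r" "ereal r < t" using t ereal_dense2 by blast
  define E where "E k = enlargement (1 / Suc k) (carrier_of K)" for k :: nat
  have KE: "carrier_of K \<subseteq> E k" for k by (simp add: E_def subset_enlargement)
  have "eventually (\<lambda>n. \<exists>L. carrier_of L \<subseteq> E k \<and> w n L < t) sequentially" for k
  proof -
    have "openin L_topology {l \<in> L_space. \<exists>K. carrier_of K \<subseteq> E k \<and> l K < ereal r}"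
      unfolding E_def by (intro openin_L_topology_below open_enlargement)
    then have "eventually (\<lambda>n. w n \<in> {l \<in> L_space. \<exists>K. carrier_of K \<subseteq> E k \<and> l K < ereal r}) sequentially"
      using lim r limitin_L_in_L_space[OF lim] KE unfolding limitin_def by blast
    then show ?thesis
      by eventually_elim (use r less_trans in blast)
  qed
  then obtain m where m: "filterlim m at_top sequentially"
    and ev: "eventually (\<lambda>n. \<exists>L. carrier_of L \<subseteq> E (m n) \<and> w n L < t) sequentially"
    by (rule diagonal_sequence)
  define L where "L n = (SOME L. carrier_of L \<subseteq> E (m n) \<and> w n L < t)" for n
  have L: "eventually (\<lambda>n. carrier_of (L n) \<subseteq> E (m n) \<and> w n (L n) < t) sequentially"
    using ev unfolding L_def by eventually_elim (rule someI_ex)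
  show ?thesis
  proof (rule that[of L])
    show "eventually (\<lambda>n. w n (L n) < t) sequentially"
      using L by eventually_elim simp
    fix G assume "open G" "carrier_of K \<subseteq> G"
    then obtain \<epsilon> where e: "0 < \<epsilon>" "enlargement \<epsilon> (carrier_of K) \<subseteq> G"
      using compact_enlargement_subset[OF compact_carrier_of] by metis
    then obtain k where k: "1 / Suc k < \<epsilon>" using nat_approx_posE by metis
    have "eventually (\<lambda>n. k \<le> m n) sequentially" using m by (simp add: filterlim_at_top)
    then show "eventually (\<lambda>n. carrier_of (L n) \<subseteq> G) sequentially"
      using L
    proof eventually_elim
      case (elim n)
      have "1 / Suc (m n) \<le> 1 / Suc k" using elim by (simp add: frac_le)
      then have "E (m n) \<subseteq> enlargement \<epsilon> (carrier_of K)"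
        unfolding E_def using k by (intro enlargement_mono) linarith
      then show ?case using elim e by blast
    qed
  qed
qed

text \<open>A single compact set serves all large \<open>n\<close>: the union of \<open>K\<close> with the tail of a recovery
  sequence. For \<open>w n = l_meas (a n) (\<mu> n)\<close> this is where tightness comes from.\<close>
lemma limitin_L_recovery_compact:
  assumes lim: "limitin L_topology w l sequentially" and t: "l K < t"
    and G: "open G" "carrier_of K \<subseteq> G"
  obtains Q where "carrier_of Q \<subseteq> G" "eventually (\<lambda>n. w n Q < t) sequentially"
proof -
  obtain L where L: "eventually (\<lambda>n. w n (L n) < t) sequentially"
    and shrink: "\<And>G. open G \<Longrightarrow> carrier_of K \<subseteq> G \<Longrightarrow> eventually (\<lambda>n. carrier_of (L n) \<subseteq> G) sequentially"
    using limitin_L_recovery_sequence[OF lim t] by metis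
  obtain N where N: "\<And>n. n \<ge> N \<Longrightarrow> carrier_of (L n) \<subseteq> G"
    using shrink[OF G] by (auto simp: eventually_sequentially)
  define A where "A = carrier_of K \<union> (\<Union>n\<in>{N..}. carrier_of (L n))"
  have A: "compact A" unfolding A_def by (intro compact_Un_shrinking) (auto intro: shrink)
  show ?thesis
  proof (rule that[of "Compacts A"])
    show "carrier_of (Compacts A) \<subseteq> G" using A N G by (auto simp: A_def)
    show "eventually (\<lambda>n. w n (Compacts A) < t) sequentially"
      using L limitin_L_eventually_in_L_space[OF lim] eventually_ge_at_top[of N]
    proof eventually_elim
      case (elim n)
      have "w n (Compacts A) \<le> w n (L n)"
        using elim A by (intro L_space_antimono) (auto simp: A_def)
      then show ?case using elim by simp
    qed
  qed
qed

section \<open>Limits that are rate functions\<close>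

text \<open>If \<open>l K\<close> were smaller than both \<open>l K1\<close> and \<open>l K2\<close>, a compact recovery set for \<open>K\<close> inside
  neighbourhoods of \<open>K1\<close> and \<open>K2\<close> would split into two compact pieces on which \<open>l\<close> is
  large, hence so is \<open>w n\<close> for large \<open>n\<close>; almost maxitivity of \<open>w n\<close> rules this out.\<close>
lemma maxitive_limit:
  fixes l :: "'a::metric_space compacts \<Rightarrow> ereal"
  assumes lim: "limitin L_topology w l sequentially" and c: "c \<longlonglongrightarrow> (0::real)"
    and almost: "\<And>n A B Q. carrier_of Q = carrier_of A \<union> carrier_of B \<Longrightarrow>
      min (w n A) (w n B) \<le> w n Q + ereal (c n)"
    and K: "carrier_of K = carrier_of K1 \<union> carrier_of K2"
  shows "min (l K1) (l K2) \<le> l K"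
proof (rule ccontr)
  assume "\<not> min (l K1) (l K2) \<le> l K"
  then have "l K < min (l K1) (l K2)" by (simp only: not_le)
  then obtain r where r: "l K < ereal r" "ereal r < min (l K1) (l K2)" using ereal_dense2 by blast
  then obtain s where s: "ereal r < ereal s" "ereal s < min (l K1) (l K2)" using ereal_dense2 by blast
  have l: "l \<in> L_space" using lim by (rule limitin_L_in_L_space)
  obtain G1 where G1: "open G1" "carrier_of K1 \<subseteq> G1" "\<And>P. carrier_of P \<subseteq> G1 \<Longrightarrow> ereal s < l P"
    by (rule L_space_outer[OF l, of "ereal s" K1]) (use s in auto)
  obtain G2 where G2: "open G2" "carrier_of K2 \<subseteq> G2" "\<And>P. carrier_of P \<subseteq> G2 \<Longrightarrow> ereal s < l P"
    by (rule L_space_outer[OF l, of "ereal s" K2]) (use s in auto)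
  obtain Q where Q: "carrier_of Q \<subseteq> G1 \<union> G2" "eventually (\<lambda>n. w n Q < ereal r) sequentially"
    by (rule limitin_L_recovery_compact[OF lim r(1), of "G1 \<union> G2"]) (use G1 G2 K in auto)
  obtain A' B' where AB': "compact A'" "compact B'" "A' \<subseteq> G1" "B' \<subseteq> G2" "carrier_of Q = A' \<union> B'"
    by (rule compact_cover_split[OF compact_carrier_of G1(1) G2(1) Q(1)])
  define A B where "A = Compacts A'" and "B = Compacts B'"
  have AB: "carrier_of A \<subseteq> G1" "carrier_of B \<subseteq> G2" "carrier_of Q = carrier_of A \<union> carrier_of B"
    using AB' by (auto simp: A_def B_def)
  have "eventually (\<lambda>n. ereal s < w n A) sequentially" "eventually (\<lambda>n. ereal s < w n B) sequentially"
    using limitin_L_liminf[OF lim] G1(3) G2(3) AB by blast+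
  moreover have "eventually (\<lambda>n. c n < s - r) sequentially"
    using c s by (intro order_tendstoD) auto
  ultimately have "eventually (\<lambda>n. False) sequentially" using Q(2)
  proof eventually_elim
    case (elim n)
    have "ereal s < min (w n A) (w n B)" using elim by simp
    also have "\<dots> \<le> w n Q + ereal (c n)" by (rule almost[OF AB(3)])
    also have "\<dots> \<le> ereal r + ereal (s - r)" using elim by (intro add_mono) auto
    finally show False by simp
  qed
  then show False by simp
qed

text \<open>If \<open>l > t\<close> at all points of \<open>K\<close>, then \<open>l > t\<close> on all compact subsets of suitable
  neighbourhoods of these points; finitely many of them cover \<open>K\<close>, and maxitivity glues the
  bounds. The value at the empty set is the start of the induction over the cover.\<close>
lemma maxitive_imp_l_rate:
  fixes l :: "'a::metric_space compacts \<Rightarrow> ereal"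
  assumes l: "l \<in> L_space" and empty: "l (Compacts {}) = \<infinity>"
    and maxitive: "\<And>A B Q. carrier_of Q = carrier_of A \<union> carrier_of B \<Longrightarrow> min (l A) (l B) \<le> l Q"
  shows "(\<lambda>x. l (Compacts {x})) \<in> rate_functions" and "l = l_rate (\<lambda>x. l (Compacts {x}))"
proof -
  have "open {x. t < l (Compacts {x})}" for t
    unfolding open_subopen[of "{x. t < l (Compacts {x})}"]
  proof (intro ballI)
    fix x assume "x \<in> {x. t < l (Compacts {x})}"
    then have "t < l (Compacts {x})" by simp
    then obtain G where "open G" "x \<in> G" "\<And>P. carrier_of P \<subseteq> G \<Longrightarrow> t < l P"
      by (rule L_space_outer[OF l, of t "Compacts {x}"]) auto
    then show "\<exists>T. open T \<and> x \<in> T \<and> T \<subseteq> {x. t < l (Compacts {x})}"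
      by (intro exI[of _ G]) auto
  qed
  then show "(\<lambda>x. l (Compacts {x})) \<in> rate_functions"
    using L_space_nonneg[OF l] by (auto simp: rate_functions_def lower_semicont_def)
  show "l = l_rate (\<lambda>x. l (Compacts {x}))"
  proof (rule ext, rule antisym)
    fix K
    show "l K \<le> l_rate (\<lambda>x. l (Compacts {x})) K"
      unfolding l_rate_def by (intro INF_greatest L_space_antimono[OF l]) auto
    show "l_rate (\<lambda>x. l (Compacts {x})) K \<le> l K"
    proof (rule ccontr)
      assume "\<not> ?thesis"
      then have "l K < l_rate (\<lambda>x. l (Compacts {x})) K" by simp
      then obtain t where t: "l K < t" "t < l_rate (\<lambda>x. l (Compacts {x})) K" using dense[of "l K"] by blast
      have "\<exists>G. open G \<and> x \<in> G \<and> (\<forall>P. carrier_of P \<subseteq> G \<longrightarrow> t < l P)" if "x \<in> carrier_of K" for x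
      proof -
        have "t < l (Compacts {x})"
          using t(2) INF_lower[OF that, of "\<lambda>x. l (Compacts {x})"] unfolding l_rate_def
          by (rule less_le_trans)
        then obtain G where "open G" "carrier_of (Compacts {x}) \<subseteq> G" "\<And>P. carrier_of P \<subseteq> G \<Longrightarrow> t < l P"
          by (rule L_space_outer[OF l]) (rule that)
        then show ?thesis by (intro exI[of _ G]) auto
      qed
      then obtain G where G: "\<And>x. x \<in> carrier_of K \<Longrightarrow> open (G x) \<and> x \<in> G x \<and> (\<forall>P. carrier_of P \<subseteq> G x \<longrightarrow> t < l P)"
        by metis
      obtain F where F: "F \<subseteq> carrier_of K" "finite F" "carrier_of K \<subseteq> (\<Union>x\<in>F. G x)"
        by (rule compactE_image[OF compact_carrier_of[of K], of "carrier_of K" G]) (use G in auto)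
      have "\<forall>P. carrier_of P \<subseteq> (\<Union>x\<in>F. G x) \<longrightarrow> t \<le> l P" using F(2,1)
      proof (induction F)
        case empty
        have "P = Compacts {}" if "carrier_of P \<subseteq> {}" for P :: "'a compacts"
          using that by (metis carrier_of_inverse subset_empty)
        then show ?case using \<open>l (Compacts {}) = \<infinity>\<close> by fastforce
      next
        case (insert x F)
        show ?case
        proof (intro allI impI)
          fix P assume P: "carrier_of P \<subseteq> (\<Union>x\<in>insert x F. G x)"
          have "open (G x)" "open (\<Union>x\<in>F. G x)" using G insert.prems by (auto intro!: open_UN)
          then obtain A B where AB: "compact A" "compact B" "A \<subseteq> G x" "B \<subseteq> (\<Union>x\<in>F. G x)" "carrier_of P = A \<union> B"
            by (rule compact_cover_split[OF compact_carrier_of[of P], of "G x" "\<Union>x\<in>F. G x"]) (use P in auto)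
          have "t \<le> l (Compacts A)" using G[of x] insert.prems AB by (intro less_imp_le) auto
          moreover have "t \<le> l (Compacts B)" using insert AB by auto
          ultimately have "t \<le> min (l (Compacts A)) (l (Compacts B))" by simp
          also have "\<dots> \<le> l P" by (rule maxitive) (use AB in auto)
          finally show "t \<le> l P" .
        qed
      qed
      then have "t \<le> l K" using F(3) by blast
      then show False using t(1) by simp
    qed
  qed
qed

lemma l_meas_eq:
  "l_meas a \<mu> K = (if measure \<mu> (carrier_of K) = 0 then ereal (1 / a) * \<infinity>
     else ereal (- ln (measure \<mu> (carrier_of K)) / a))"
  by (auto simp: l_meas_def elog_def)

lemma l_meas_less_iff:
  assumes "0 < a"
  shows "l_meas a \<mu> K < ereal t \<longleftrightarrow> exp (- a * t) < measure \<mu> (carrier_of K)"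
proof (cases "measure \<mu> (carrier_of K) = 0")
  case True
  then show ?thesis using assms by (simp add: l_meas_eq)
next
  case False
  then have m: "0 < measure \<mu> (carrier_of K)" by (simp add: zero_less_measure_iff)
  have "l_meas a \<mu> K < ereal t \<longleftrightarrow> - a * t < ln (measure \<mu> (carrier_of K))"
    using False assms by (simp add: l_meas_eq field_simps) linarith
  also have "\<dots> \<longleftrightarrow> exp (- a * t) < measure \<mu> (carrier_of K)"
    using m by (metis exp_less_cancel_iff exp_ln)
  finally show ?thesis .
qed

lemma less_l_meas_iff:
  assumes "0 < a"
  shows "ereal t < l_meas a \<mu> K \<longleftrightarrow> measure \<mu> (carrier_of K) < exp (- a * t)"
proof (cases "measure \<mu> (carrier_of K) = 0")
  case True
  then show ?thesis using assms by (simp add: l_meas_eq)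
next
  case False
  then have m: "0 < measure \<mu> (carrier_of K)" by (simp add: zero_less_measure_iff)
  have "ereal t < l_meas a \<mu> K \<longleftrightarrow> ln (measure \<mu> (carrier_of K)) < - a * t"
    using False assms by (simp add: l_meas_eq field_simps) linarith
  also have "\<dots> \<longleftrightarrow> measure \<mu> (carrier_of K) < exp (- a * t)"
    using m by (metis exp_less_cancel_iff exp_ln)
  finally show ?thesis .
qed

lemma prob_measuresD:
  assumes "\<mu> \<in> prob_measures"
  shows "prob_space \<mu>" "sets \<mu> = sets borel" "space \<mu> = UNIV"
  using assms sets_eq_imp_space_eq[of \<mu> borel] by (auto simp: prob_measures_def)

text \<open>One of the two pieces carries at least half of the mass of the union.\<close>
lemma l_meas_almost_maxitive:
  fixes \<mu> :: "'a::metric_space measure"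
  assumes \<mu>: "\<mu> \<in> prob_measures" and a: "0 < a" and Q: "carrier_of Q = carrier_of A \<union> carrier_of B"
  shows "min (l_meas a \<mu> A) (l_meas a \<mu> B) \<le> l_meas a \<mu> Q + ereal (ln 2 / a)"
proof -
  interpret prob_space \<mu> using \<mu> by (rule prob_measuresD)
  have half: "l_meas a \<mu> C \<le> l_meas a \<mu> Q + ereal (ln 2 / a)"
    if C: "measure \<mu> (carrier_of Q) \<le> 2 * measure \<mu> (carrier_of C)" for C
  proof (cases "measure \<mu> (carrier_of Q) = 0")
    case True
    then show ?thesis using a by (simp add: l_meas_eq)
  next
    case False
    then have "0 < measure \<mu> (carrier_of Q)" by (simp add: zero_less_measure_iff)
    moreover from this C have "0 < measure \<mu> (carrier_of C)" by simp
    moreover from calculation have "ln (measure \<mu> (carrier_of Q)) \<le> ln (2 * measure \<mu> (carrier_of C))"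
      using C by (subst ln_le_cancel_iff) auto
    ultimately have "- ln (measure \<mu> (carrier_of C)) \<le> - ln (measure \<mu> (carrier_of Q)) + ln 2"
      by (simp add: ln_mult)
    from divide_right_mono[OF this, of a] a False \<open>0 < measure \<mu> (carrier_of C)\<close> show ?thesis
      by (simp add: l_meas_eq add_divide_distrib diff_divide_distrib)
  qed
  have "measure \<mu> (carrier_of Q) \<le> measure \<mu> (carrier_of A) + measure \<mu> (carrier_of B)"
    unfolding Q by (intro measure_Un_le) (auto simp: prob_measuresD[OF \<mu>] intro!: borel_compact)
  then have "measure \<mu> (carrier_of Q) \<le> 2 * measure \<mu> (carrier_of A) \<or> measure \<mu> (carrier_of Q) \<le> 2 * measure \<mu> (carrier_of B)"
    by linarith
  then show ?thesis using half by (meson min.coboundedI1 min.coboundedI2)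
qed

lemma l_rate_maxitive:
  "carrier_of Q = carrier_of A \<union> carrier_of B \<Longrightarrow> min (l_rate I A) (l_rate I B) \<le> l_rate I Q"
  by (simp add: l_rate_def INF_union inf_min)

lemma W_space_empty:
  assumes "l \<in> W_space"
  shows "l (Compacts {}) = \<infinity>"
  using assms by (auto simp: W_space_def U_space_def V_space_def l_meas_eq l_rate_def top_ereal_def)

lemma elog_mono: "0 \<le> p \<Longrightarrow> p \<le> q \<Longrightarrow> elog p \<le> elog q"
  by (auto simp: elog_def)

text \<open>The error \<open>ln 2 / a n\<close> in maxitivity vanishes in the limit, so the limit is a rate function.
  The bound on compact sets is the lower bound of \<open>\<Gamma>\<close>-convergence at a constant sequence; the bound on
  open sets follows from recovery sets around single points.\<close>
theorem weak_LDP_of_limit: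
  fixes \<mu> :: "nat \<Rightarrow> 'a::metric_space measure"
  assumes lim: "limitin L_topology w l sequentially" and empty: "l (Compacts {}) = \<infinity>"
    and w: "\<And>n. 0 < a n" "\<And>n. \<mu> n \<in> prob_measures" "\<And>n. w n = l_meas (a n) (\<mu> n)"
    and a: "filterlim a at_top sequentially"
  shows "\<exists>I \<in> rate_functions. l = l_rate I \<and> weak_LDP a \<mu> I"
proof -
  have l: "l \<in> L_space" using lim by (rule limitin_L_in_L_space)
  have "(\<lambda>n. ln 2 / a n) \<longlonglongrightarrow> 0"
    using a by (intro tendsto_divide_0[OF tendsto_const]) (simp add: filterlim_at_top_imp_at_infinity)
  then have max: "min (l A) (l B) \<le> l Q" if "carrier_of Q = carrier_of A \<union> carrier_of B" for A B Q
    by (rule maxitive_limit[OF lim _ _ that]) (simp add: w l_meas_almost_maxitive)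
  define I where "I x = l (Compacts {x})" for x
  have I: "I \<in> rate_functions" and lI: "l = l_rate I"
    unfolding I_def by (rule maxitive_imp_l_rate[OF l empty max]; assumption)+
  have neg: "ereal (1 / a n) * elog (measure (\<mu> n) (carrier_of K)) = - w n K" for n K
    by (simp add: w l_meas_def)
  have "weak_LDP a \<mu> I"
    unfolding weak_LDP_def
  proof (intro conjI allI impI)
    fix G :: "'a set" assume G: "open G"
    show "- (INF x\<in>G. I x) \<le> liminf (\<lambda>n. ereal (1 / a n) * elog (measure (\<mu> n) G))"
      unfolding le_Liminf_iff
    proof (intro allI impI)
      fix y assume "y < - (INF x\<in>G. I x)"
      then have "(INF x\<in>G. I x) < - y" using ereal_less_uminus_reorder by blast
      then obtain x where x: "x \<in> G" "l (Compacts {x}) < - y" by (auto simp: INF_less_iff I_def)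
      obtain Q where Q: "carrier_of Q \<subseteq> G" "eventually (\<lambda>n. w n Q < - y) sequentially"
        by (rule limitin_L_recovery_compact[OF lim x(2) G]) (use x in auto)
      from Q(2) show "eventually (\<lambda>n. y < ereal (1 / a n) * elog (measure (\<mu> n) G)) sequentially"
      proof eventually_elim
        case (elim n)
        interpret prob_space "\<mu> n" using w by (intro prob_measuresD)
        have "y < - w n Q" using elim ereal_less_uminus_reorder by blast
        also have "\<dots> = ereal (1 / a n) * elog (measure (\<mu> n) (carrier_of Q))" by (simp add: neg)
        also have "\<dots> \<le> ereal (1 / a n) * elog (measure (\<mu> n) G)"
          using w Q(1) G prob_measuresD[OF w(2)[of n]]
          by (intro ereal_mult_left_mono elog_mono finite_measure_mono) (auto simp: less_imp_le)
        finally show ?case .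
      qed
    qed
  next
    fix K :: "'a set" assume K: "compact K"
    have *: "l (Compacts K) \<le> liminf (\<lambda>n. w n (Compacts K))"
      unfolding le_Liminf_iff using limitin_L_liminf[OF lim] by blast
    have "limsup (\<lambda>n. ereal (1 / a n) * elog (measure (\<mu> n) K)) = limsup (\<lambda>n. - w n (Compacts K))"
      using neg[of _ "Compacts K"] K by simp
    also have "\<dots> = - liminf (\<lambda>n. w n (Compacts K))" by (rule ereal_Limsup_uminus)
    also have "\<dots> \<le> - (INF x\<in>K. I x)" using * K by (simp add: lI l_rate_def)
    finally show "limsup (\<lambda>n. ereal (1 / a n) * elog (measure (\<mu> n) K)) \<le> - (INF x\<in>K. I x)" .
  qed
  with I lI show ?thesis by blast
qed

lemma le_l_rate: "x \<in> carrier_of K \<Longrightarrow> l_rate I K \<le> I x"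
  unfolding l_rate_def by (rule INF_lower)

text \<open>A sequence \<open>y\<close> converging to \<open>x\<close> is tested against the compact set formed by \<open>x\<close> and a tail
  of \<open>y\<close>; conversely, choosing points in a recovery sequence for \<open>{x}\<close> gives a recovery sequence
  for the rate functions.\<close>
theorem gamma_converges_of_limit:
  fixes J :: "nat \<Rightarrow> 'a::metric_space \<Rightarrow> ereal"
  assumes lim: "limitin L_topology w l sequentially" and empty: "l (Compacts {}) = \<infinity>"
    and w: "\<And>n. w n = l_rate (J n)"
  shows "\<exists>I \<in> rate_functions. l = l_rate I \<and> gamma_converges J I"
proof -
  have l: "l \<in> L_space" using lim by (rule limitin_L_in_L_space)
  have max: "min (l A) (l B) \<le> l Q" if "carrier_of Q = carrier_of A \<union> carrier_of B" for A B Q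
    by (rule maxitive_limit[OF lim tendsto_const _ that]) (simp add: w l_rate_maxitive)
  define I where "I x = l (Compacts {x})" for x
  have I: "I \<in> rate_functions" and lI: "l = l_rate I"
    unfolding I_def by (rule maxitive_imp_l_rate[OF l empty max]; assumption)+
  have lower: "I x \<le> liminf (\<lambda>n. J n (y n))" if y: "y \<longlonglongrightarrow> x" for x y
    unfolding le_Liminf_iff
  proof (intro allI impI)
    fix t assume "t < I x"
    then have "t < l (Compacts {x})" by (simp add: I_def)
    then obtain G where G: "open G" "x \<in> G" "\<And>P. carrier_of P \<subseteq> G \<Longrightarrow> t < l P"
      by (rule L_space_outer[OF l, of t "Compacts {x}"]) auto
    have shrink: "eventually (\<lambda>n. {y n} \<subseteq> U) sequentially" if "open U" "{x} \<subseteq> U" for U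
      using topological_tendstoD[OF y that(1)] that by simp
    obtain N where N: "\<And>n. n \<ge> N \<Longrightarrow> y n \<in> G"
      using shrink[OF G(1)] G(2) by (auto simp: eventually_sequentially)
    define Q where "Q = Compacts ({x} \<union> (\<Union>n\<in>{N..}. {y n}))"
    have Q: "carrier_of Q = {x} \<union> (\<Union>n\<in>{N..}. {y n})"
      unfolding Q_def by (intro carrier_of_Compacts compact_Un_shrinking shrink) auto
    have "t < l Q" using G N by (intro G(3)) (auto simp: Q)
    then have "eventually (\<lambda>n. t < w n Q) sequentially" by (rule limitin_L_liminf[OF lim])
    then show "eventually (\<lambda>n. t < J n (y n)) sequentially" using eventually_ge_at_top[of N]
    proof eventually_elim
      case (elim n)
      then have "w n Q \<le> J n (y n)" unfolding w by (intro le_l_rate) (auto simp: Q)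
      then show ?case using elim by simp
    qed
  qed
  have upper: "Inf {limsup (\<lambda>n. J n (y n)) | y. y \<longlonglongrightarrow> x} \<le> I x" for x
  proof (rule dense_ge)
    fix t assume "I x < t"
    then have "l (Compacts {x}) < t" by (simp add: I_def)
    then obtain L where L: "eventually (\<lambda>n. w n (L n) < t) sequentially"
      and shrink: "\<And>G. open G \<Longrightarrow> x \<in> G \<Longrightarrow> eventually (\<lambda>n. carrier_of (L n) \<subseteq> G) sequentially"
      by (rule limitin_L_recovery_sequence[OF lim]) auto
    define y where "y n = (SOME y. y \<in> carrier_of (L n) \<and> J n y < t)" for n
    have y: "eventually (\<lambda>n. y n \<in> carrier_of (L n) \<and> J n (y n) < t) sequentially"
      using L
    proof eventually_elim
      case (elim n)
      then have "\<exists>y. y \<in> carrier_of (L n) \<and> J n y < t" by (auto simp: w l_rate_def INF_less_iff)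
      then show ?case unfolding y_def by (rule someI_ex)
    qed
    have "y \<longlonglongrightarrow> x"
    proof (rule topological_tendstoI)
      fix S assume "open S" "x \<in> S"
      from shrink[OF this] y show "eventually (\<lambda>n. y n \<in> S) sequentially" by eventually_elim auto
    qed
    then have "Inf {limsup (\<lambda>n. J n (y n)) | y. y \<longlonglongrightarrow> x} \<le> limsup (\<lambda>n. J n (y n))"
      by (intro Inf_lower) auto
    also have "\<dots> \<le> t"
      by (rule Limsup_bounded) (use y in \<open>auto elim: eventually_mono\<close>)
    finally show "Inf {limsup (\<lambda>n. J n (y n)) | y. y \<longlonglongrightarrow> x} \<le> t" .
  qed
  have "gamma_converges J I"
    unfolding gamma_converges_def
  proof (intro allI)
    fix x
    let ?i = "Inf {liminf (\<lambda>n. J n (y n)) | y. y \<longlonglongrightarrow> x}"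
    let ?s = "Inf {limsup (\<lambda>n. J n (y n)) | y. y \<longlonglongrightarrow> x}"
    have "I x \<le> ?i" by (rule Inf_greatest) (auto intro: lower)
    moreover have "?i \<le> ?s"
      by (rule Inf_mono) (auto intro!: Liminf_le_Limsup)
    ultimately show "I x = ?i \<and> I x = ?s" using upper[of x] by auto
  qed
  with I lI show ?thesis by blast
qed

section \<open>Narrow convergence and Dirac masses\<close>

lemma limitin_topology_generated_byI:
  assumes l: "l \<in> \<Union>S"
    and sub: "\<And>U. U \<in> S \<Longrightarrow> l \<in> U \<Longrightarrow> eventually (\<lambda>n. f n \<in> U) F"
  shows "limitin (topology_generated_by S) f l F"
  unfolding limitin_def
proof (intro conjI allI impI)
  show "l \<in> topspace (topology_generated_by S)" using l by simp
  fix U assume "openin (topology_generated_by S) U \<and> l \<in> U"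
  then have "generate_topology_on S U" "l \<in> U" by (auto dest: openin_topology_generated_by)
  then show "eventually (\<lambda>n. f n \<in> U) F"
  proof induction
    case (Int a b)
    then show ?case by (auto intro: eventually_conj)
  next
    case (UN K)
    then obtain k where "k \<in> K" "l \<in> k" by blast
    with UN have "eventually (\<lambda>n. f n \<in> k) F" by blast
    then show ?case by (rule eventually_mono) (use \<open>k \<in> K\<close> in blast)
  qed (use sub in auto)
qed

text \<open>The half of the portmanteau theorem that starts from open sets. Images under a bounded
  continuous \<open>f\<close> reduce it to the real line: sublevel sets of \<open>f\<close> control the distribution functions from both sides,
  and these coincide at continuity points of the limit.\<close>
lemma limitin_narrow_topologyI:
  fixes \<mu> :: "nat \<Rightarrow> 'a::metric_space measure"
  assumes \<mu>: "\<And>n. \<mu> n \<in> prob_measures" and \<nu>: "\<nu> \<in> prob_measures"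
    and liminf: "\<And>G s. open G \<Longrightarrow> s < measure \<nu> G \<Longrightarrow> eventually (\<lambda>n. s < measure (\<mu> n) G) sequentially"
  shows "limitin narrow_topology \<mu> \<nu> sequentially"
proof -
  have int: "(\<lambda>n. \<integral>x. f x \<partial>\<mu> n) \<longlonglongrightarrow> (\<integral>x. f x \<partial>\<nu>)"
    if f: "continuous_on UNIV f" and bdd: "bounded (range f)" for f :: "'a \<Rightarrow> real"
  proof -
    obtain B where B: "\<And>x. \<bar>f x\<bar> \<le> B" using bdd by (auto simp: bounded_iff)
    have meas: "f \<in> borel_measurable \<rho>" if "\<rho> \<in> prob_measures" for \<rho>
      using borel_measurable_continuous_onI[OF f] prob_measuresD[OF that]
      by (simp cong: measurable_cong_sets)
    have open_lt: "open {x. f x < c}" for c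
      using f by (intro open_Collect_less) auto
    have sets: "{x. f x < c} \<in> sets \<rho>" "{x. f x \<le> c} \<in> sets \<rho>" "{x. c < f x} \<in> sets \<rho>" if "\<rho> \<in> prob_measures" for \<rho> c
    proof -
      have "open {x. f x < c}" "closed {x. f x \<le> c}" "open {x. c < f x}"
        using f by (auto intro!: open_Collect_less closed_Collect_le)
      then show "{x. f x < c} \<in> sets \<rho>" "{x. f x \<le> c} \<in> sets \<rho>" "{x. c < f x} \<in> sets \<rho>"
        by (simp_all add: prob_measuresD(2)[OF that])
    qed
    have distr: "real_distribution (distr \<rho> borel f)" if "\<rho> \<in> prob_measures" for \<rho>
      using prob_space.real_distribution_distr[OF prob_measuresD(1)[OF that]] meas[OF that] by simp
    have cdf: "cdf (distr \<rho> borel f) c = measure \<rho> {x. f x \<le> c}" if "\<rho> \<in> prob_measures" for \<rho> c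
      unfolding cdf_def using meas[OF that] prob_measuresD(3)[OF that]
      by (subst measure_distr) (auto intro!: arg_cong[where f="measure \<rho>"])
    have weak: "weak_conv_m (\<lambda>n. distr (\<mu> n) borel f) (distr \<nu> borel f)"
      unfolding weak_conv_m_def weak_conv_def
    proof (intro allI impI)
      fix c assume cont: "isCont (cdf (distr \<nu> borel f)) c"
      interpret \<nu>: prob_space \<nu> using \<nu> by (rule prob_measuresD)
      interpret D: real_distribution "distr \<nu> borel f" by (rule distr[OF \<nu>])
      have "measure (distr \<nu> borel f) {c} = 0" using cont D.isCont_cdf by blast
      then have null: "measure \<nu> {x. f x = c} = 0"
        using meas[OF \<nu>] prob_measuresD(3)[OF \<nu>] by (simp add: measure_distr vimage_def)
      have "{x. f x \<le> c} = {x. f x < c} \<union> {x. f x = c}" by auto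
      moreover have "{x. f x = c} \<in> sets \<nu>"
        using f prob_measuresD(2)[OF \<nu>] by (auto intro!: borel_closed closed_Collect_eq)
      ultimately have "measure \<nu> {x. f x \<le> c} \<le> measure \<nu> {x. f x < c} + measure \<nu> {x. f x = c}"
        using measure_Un_le[OF sets(1)[OF \<nu>]] by metis
      then have le: "measure \<nu> {x. f x \<le> c} \<le> measure \<nu> {x. f x < c}" using null by simp
      show "(\<lambda>n. cdf (distr (\<mu> n) borel f) c) \<longlonglongrightarrow> cdf (distr \<nu> borel f) c"
        unfolding cdf[OF \<mu>] cdf[OF \<nu>]
      proof (rule order_tendstoI)
        fix s assume "s < measure \<nu> {x. f x \<le> c}"
        with le have "s < measure \<nu> {x. f x < c}" by simp
        from liminf[OF open_lt this]
        show "eventually (\<lambda>n. s < measure (\<mu> n) {x. f x \<le> c}) sequentially"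
        proof eventually_elim
          case (elim n)
          interpret prob_space "\<mu> n" using \<mu> by (rule prob_measuresD)
          have "measure (\<mu> n) {x. f x < c} \<le> measure (\<mu> n) {x. f x \<le> c}"
            using sets[OF \<mu>] by (intro finite_measure_mono) auto
          then show ?case using elim by simp
        qed
      next
        fix s assume s: "measure \<nu> {x. f x \<le> c} < s"
        have compl: "measure \<rho> {x. f x \<le> c} = 1 - measure \<rho> {x. c < f x}" if \<rho>: "\<rho> \<in> prob_measures" for \<rho>
        proof -
          interpret prob_space \<rho> using \<rho> by (rule prob_measuresD)
          have "{x. f x \<le> c} = space \<rho> - {x. c < f x}" using prob_measuresD(3)[OF \<rho>] by auto
          then show ?thesis using prob_compl[OF sets(3)[OF \<rho>]] by metis
        qed
        have "1 - s < measure \<nu> {x. c < f x}" using s compl[OF \<nu>] by simp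
        moreover have "open {x. c < f x}" using f by (intro open_Collect_less) auto
        ultimately have "eventually (\<lambda>n. 1 - s < measure (\<mu> n) {x. c < f x}) sequentially"
          using liminf by blast
        then show "eventually (\<lambda>n. measure (\<mu> n) {x. f x \<le> c} < s) sequentially"
          by eventually_elim (simp add: compl[OF \<mu>])
      qed
    qed
    \<comment> \<open>Truncation at the bound of \<open>f\<close> replaces the identity, which is not bounded, and does not change the integrals.\<close>
    define \<phi> where "\<phi> y = max (- B) (min B y)" for y :: real
    have \<phi>: "\<phi> (f x) = f x" for x using B[of x] by (auto simp: \<phi>_def)
    have "0 \<le> B" using B[of undefined] by linarith
    have "isCont \<phi> y" for y unfolding \<phi>_def by (intro continuous_intros)
    moreover have "norm (\<phi> y) \<le> B" for y using \<open>0 \<le> B\<close> by (auto simp: \<phi>_def)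
    ultimately have "(\<lambda>n. \<integral>y. \<phi> y \<partial>distr (\<mu> n) borel f) \<longlonglongrightarrow> (\<integral>y. \<phi> y \<partial>distr \<nu> borel f)"
      using weak_conv_imp_integral_bdd_continuous_conv[OF _ _ weak] distr \<mu> \<nu> by blast
    moreover have "(\<integral>y. \<phi> y \<partial>distr \<rho> borel f) = (\<integral>x. f x \<partial>\<rho>)" if "\<rho> \<in> prob_measures" for \<rho>
    proof -
      have "\<phi> \<in> borel_measurable borel" unfolding \<phi>_def by measurable
      then show ?thesis using meas[OF that] by (subst integral_distr) (simp_all add: \<phi>)
    qed
    ultimately show ?thesis using \<mu> \<nu> by simp
  qed
  show ?thesis
    unfolding narrow_topology_def
  proof (rule limitin_topology_generated_byI)
    show "\<nu> \<in> \<Union>{{\<mu> \<in> prob_measures. (\<integral>x. f x \<partial>\<mu>) \<in> V} | (f :: 'a \<Rightarrow> real) V.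
        continuous_on UNIV f \<and> bounded (range f) \<and> open V}"
      using \<nu> by (intro UnionI[of "{\<mu> \<in> prob_measures. (\<integral>x. (0::real) \<partial>\<mu>) \<in> UNIV}"] CollectI
          exI[of _ "\<lambda>_. 0"] exI[of _ UNIV]) auto
  next
    fix U :: "'a measure set"
    assume "U \<in> {{\<mu> \<in> prob_measures. (\<integral>x. f x \<partial>\<mu>) \<in> V} | (f :: 'a \<Rightarrow> real) V.
        continuous_on UNIV f \<and> bounded (range f) \<and> open V}" and "\<nu> \<in> U"
    then obtain f :: "'a \<Rightarrow> real" and V where *: "U = {\<mu> \<in> prob_measures. (\<integral>x. f x \<partial>\<mu>) \<in> V}" "continuous_on UNIV f"
      "bounded (range f)" "open V" "(\<integral>x. f x \<partial>\<nu>) \<in> V" by blast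
    from topological_tendstoD[OF int[OF *(2,3)] *(4,5)]
    show "eventually (\<lambda>n. \<mu> n \<in> U) sequentially"
      by eventually_elim (use *(1) \<mu> in auto)
  qed
qed

text \<open>Inner regularity of finite Borel measures on a Polish space, in terms of real-valued measures.\<close>
lemma compact_inner_approximation:
  fixes \<nu> :: "'a::polish_space measure"
  assumes \<nu>: "\<nu> \<in> prob_measures" and B: "B \<in> sets borel" and s: "s < measure \<nu> B"
  obtains K where "carrier_of K \<subseteq> B" "s < measure \<nu> (carrier_of K)"
proof (cases "s < 0")
  case True
  then show ?thesis by (intro that[of "Compacts {}"]) auto
next
  case False
  interpret prob_space \<nu> using \<nu> by (rule prob_measuresD)
  have "ennreal s < emeasure \<nu> B" using False s by (simp add: emeasure_eq_measure ennreal_lessI)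
  also have "\<dots> = (SUP K \<in> {K. K \<subseteq> B \<and> compact K}. emeasure \<nu> K)"
    using inner_regular[OF prob_measuresD(2)[OF \<nu>] _ B] by simp
  finally obtain K where "K \<subseteq> B" "compact K" "ennreal s < emeasure \<nu> K"
    by (auto simp: less_SUP_iff)
  then show ?thesis using False
    by (intro that[of "Compacts K"]) (auto simp: emeasure_eq_measure ennreal_less_iff)
qed

lemma prob_measures_sets: "\<nu> \<in> prob_measures \<Longrightarrow> open G \<Longrightarrow> G \<in> sets \<nu>"
  "\<nu> \<in> prob_measures \<Longrightarrow> closed G \<Longrightarrow> G \<in> sets \<nu>"
  by (simp_all add: prob_measuresD)

lemma prob_measures_disjoint_le_1:
  assumes \<mu>: "\<mu> \<in> prob_measures" and "open G" "open H" "G \<inter> H = {}"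
  shows "measure \<mu> G + measure \<mu> H \<le> 1"
proof -
  interpret prob_space \<mu> using \<mu> by (rule prob_measuresD)
  have "measure \<mu> G + measure \<mu> H = measure \<mu> (G \<union> H)"
    using assms by (intro finite_measure_Union[symmetric]) (auto simp: prob_measures_sets)
  then show ?thesis by simp
qed

lemma return_prob_measures: "return borel x \<in> prob_measures"
  by (auto simp: prob_measures_def intro: prob_space_return)

text \<open>A compact set of positive mass contains a point of mass 1: otherwise each of its points would have a
  neighbourhood of mass less than 1, hence 0, and finitely many of these would cover it.\<close>
lemma zero_one_measure_is_Dirac:
  fixes \<nu> :: "'a::polish_space measure"
  assumes \<nu>: "\<nu> \<in> prob_measures" and zo: "\<And>B. B \<in> sets borel \<Longrightarrow> measure \<nu> B = 0 \<or> measure \<nu> B = 1"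
  shows "\<exists>x. \<nu> = return borel x"
proof -
  interpret prob_space \<nu> using \<nu> by (rule prob_measuresD)
  note [simp] = prob_measuresD(2,3)[OF \<nu>]
  have "0 < measure \<nu> UNIV" using prob_space by simp
  then obtain K where K: "0 < measure \<nu> (carrier_of K)"
    by (rule compact_inner_approximation[OF \<nu>, of UNIV 0, rotated]) auto
  have "\<exists>x\<in>carrier_of K. measure \<nu> {x} = 1"
  proof (rule ccontr)
    assume neg: "\<not> ?thesis"
    have "\<exists>G. open G \<and> x \<in> G \<and> measure \<nu> G = 0" if "x \<in> carrier_of K" for x
    proof -
      have "measure \<nu> {x} = 0" using zo[of "{x}"] neg that by auto
      then have "0 < measure \<nu> (- {x})" using prob_compl[of "{x}"] by (simp add: Compl_eq_Diff_UNIV)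
      have "{x} = (\<Inter>n. ball x (1 / Suc n))"
      proof -
        have "y = x" if "\<And>n. y \<in> ball x (1 / Suc n)" for y
        proof (rule ccontr)
          assume "y \<noteq> x"
          then obtain n where "1 / Suc n < dist x y" using nat_approx_posE[of "dist x y"] by auto
          with that[of n] show False by simp
        qed
        then show ?thesis by auto
      qed
      moreover have "(\<lambda>n. measure \<nu> (ball x (1 / Suc n))) \<longlonglongrightarrow> measure \<nu> (\<Inter>n. ball x (1 / Suc n))"
        by (intro finite_Lim_measure_decseq) (auto simp: decseq_def intro!: subset_ball frac_le)
      ultimately have "(\<lambda>n. measure \<nu> (ball x (1 / Suc n))) \<longlonglongrightarrow> 0" using \<open>measure \<nu> {x} = 0\<close> by simp
      then have "eventually (\<lambda>n. measure \<nu> (ball x (1 / Suc n)) < 1) sequentially"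
        by (rule order_tendstoD) simp
      then obtain n where "measure \<nu> (ball x (1 / Suc n)) < 1" by (auto simp: eventually_sequentially)
      then have "measure \<nu> (ball x (1 / Suc n)) = 0" using zo[of "ball x (1 / Suc n)"] by auto
      then show ?thesis by (intro exI[of _ "ball x (1 / Suc n)"]) auto
    qed
    then obtain G where G: "\<And>x. x \<in> carrier_of K \<Longrightarrow> open (G x) \<and> x \<in> G x \<and> measure \<nu> (G x) = 0" by metis
    obtain F where F: "F \<subseteq> carrier_of K" "finite F" "carrier_of K \<subseteq> (\<Union>x\<in>F. G x)"
      by (rule compactE_image[OF compact_carrier_of[of K], of "carrier_of K" G]) (use G in auto)
    have "measure \<nu> (carrier_of K) \<le> measure \<nu> (\<Union>x\<in>F. G x)"
      using F G by (intro finite_measure_mono) (auto intro!: borel_open)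
    also have "\<dots> \<le> (\<Sum>x\<in>F. measure \<nu> (G x))"
      using F G by (intro finite_measure_subadditive_finite) (auto intro!: borel_open)
    also have "\<dots> = 0" using F G by (intro sum.neutral) auto
    finally show False using K by simp
  qed
  then obtain x where x: "measure \<nu> {x} = 1" by blast
  have "\<nu> = return borel x"
  proof (rule measure_eqI)
    fix A assume A: "A \<in> sets \<nu>"
    have AE: "AE y in \<nu>. y = x"
      using x prob_eq_1[of "{x}"] by simp
    have "emeasure \<nu> A = emeasure \<nu> (if x \<in> A then space \<nu> else {})"
      by (rule emeasure_eq_AE) (use A AE in auto)
    then show "emeasure \<nu> A = emeasure (return borel x) A"
      using A emeasure_space_1 by (auto simp: indicator_def)
  qed simp
  then show ?thesis by blast
qed

section \<open>Limits with bounded speed\<close>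

text \<open>Near a point where \<open>I < t\<close>, the measures \<open>\<mu> n\<close> eventually have mass greater than \<open>exp (- A * t)\<close>.
  Two distinct points have disjoint neighbourhoods, and the two masses cannot add up to more
  than 1. With infimum 0 this leaves exactly one point \<open>x\<close> with \<open>I x = 0\<close>, around which the
  mass tends to 1, so that \<open>I\<close> is infinite at all other points.\<close>
lemma bounded_speed_rate_limit_is_Dirac:
  fixes \<mu> :: "nat \<Rightarrow> 'a::metric_space measure"
  assumes lim: "limitin L_topology w (l_rate I) sequentially"
    and I: "I \<in> rate_functions" and inf: "(INF K. l_rate I K) = 0"
    and w: "\<And>n. 0 < a n" "\<And>n. \<mu> n \<in> prob_measures" "\<And>n. w n = l_meas (a n) (\<mu> n)"
    and bdd: "\<And>n. a n \<le> A"
  shows "\<exists>x. l_rate I = l_meas 1 (return borel x) \<and> limitin narrow_topology \<mu> (return borel x) sequentially"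
proof -
  have A: "0 < A" using w(1)[of 0] bdd[of 0] by linarith
  have mass: "eventually (\<lambda>n. exp (- A * t) < measure (\<mu> n) G) sequentially"
    if G: "open G" "x \<in> G" and t: "0 < t" "I x < ereal t" for G x t
  proof -
    have "l_rate I (Compacts {x}) < ereal t" using t by (simp add: l_rate_def)
    then obtain Q where Q: "carrier_of Q \<subseteq> G" "eventually (\<lambda>n. w n Q < ereal t) sequentially"
      by (rule limitin_L_recovery_compact[OF lim _ G(1)]) (use G in auto)
    from Q(2) show ?thesis
    proof eventually_elim
      case (elim n)
      interpret prob_space "\<mu> n" using w by (intro prob_measuresD)
      have "exp (- A * t) \<le> exp (- a n * t)" using bdd[of n] t by simp
      also have "\<dots> < measure (\<mu> n) (carrier_of Q)" using elim w by (simp add: l_meas_less_iff)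
      also have "\<dots> \<le> measure (\<mu> n) G"
        using Q(1) G prob_measures_sets[OF w(2)] by (intro finite_measure_mono) auto
      finally show ?case .
    qed
  qed
  \<comment> \<open>Below this level a neighbourhood carries more than half of the mass.\<close>
  define t0 where "t0 = ln 2 / A"
  have t0: "0 < t0" "exp (- A * t0) = 1 / 2" using A by (auto simp: t0_def exp_minus)
  have small: "\<exists>x. I x < ereal t" if "0 < t" for t
  proof -
    have "(INF K. l_rate I K) < ereal t" using that inf by simp
    then show ?thesis by (auto simp: INF_less_iff l_rate_def)
  qed
  have separated: False
    if "x \<noteq> y" and x: "0 < t" "I x < ereal t" and y: "0 < s" "I y < ereal s"
      and sum: "1 \<le> exp (- A * t) + exp (- A * s)" for x y t s
  proof -
    obtain G H where GH: "open G" "open H" "x \<in> G" "y \<in> H" "G \<inter> H = {}"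
      using hausdorff[OF \<open>x \<noteq> y\<close>] by blast
    have "eventually (\<lambda>n. False) sequentially"
      using mass[OF GH(1,3) x] mass[OF GH(2,4) y]
    proof eventually_elim
      case (elim n)
      then show False using prob_measures_disjoint_le_1[OF w(2)[of n] GH(1,2,5)] sum by linarith
    qed
    then show False by simp
  qed
  obtain x where x: "I x < ereal t0" using small t0 by blast
  have Ix: "I x < ereal t" if "0 < t" for t
  proof -
    have "0 < min t t0" using that t0 by simp
    from small[OF this] obtain y where y: "I y < ereal (min t t0)" by blast
    have yt: "I y < ereal t0" "I y < ereal t" by (rule less_le_trans[OF y]; simp)+
    have "y = x"
    proof (rule ccontr)
      assume "y \<noteq> x"
      then show False by (rule separated[OF _ t0(1) yt(1) t0(1) x]) (use t0(2) in linarith)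
    qed
    with yt show ?thesis by simp
  qed
  have I0: "I x = 0"
  proof (rule antisym)
    show "I x \<le> 0"
    proof (rule ccontr)
      assume "\<not> I x \<le> 0"
      then have "0 < I x" by (simp only: not_le)
      then obtain r where "0 < ereal r" "ereal r < I x" using ereal_dense2 by blast
      with Ix[of r] show False by simp
    qed
    show "0 \<le> I x" using I by (simp add: rate_functions_def)
  qed
  have Iy: "I y = \<infinity>" if "y \<noteq> x" for y
  proof (rule ccontr)
    assume "I y \<noteq> \<infinity>"
    then obtain s :: real where s: "I y < ereal s" unfolding less_PInf_Ex_of_nat by blast
    have s: "I y < ereal (max 1 s)" by (rule less_le_trans[OF s]) simp
    define p where "p = exp (- A * max 1 s)"
    have p: "0 < p" "p < 1" using A by (auto simp: p_def)
    \<comment> \<open>Small enough for \<open>x\<close> to take at least the mass \<open>1 - p\<close>, while \<open>y\<close> takes more than \<open>p\<close>.\<close>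
    define t where "t = - ln (1 - p) / A"
    have t: "0 < t" "exp (- A * t) = 1 - p" using A p by (simp_all add: t_def divide_pos_pos divide_neg_pos)
    show False
    proof (rule separated[OF that _ s t(1) Ix[OF t(1)]])
      show "1 \<le> exp (- A * max 1 s) + exp (- A * t)" using t(2) p_def by linarith
    qed simp
  qed
  have "l_rate I K = l_meas 1 (return borel x) K" for K
  proof (cases "x \<in> carrier_of K")
    case True
    have "l_rate I K = 0"
    proof (rule antisym)
      show "l_rate I K \<le> 0" using le_l_rate[OF True, of I] I0 by simp
      show "0 \<le> l_rate I K"
        unfolding l_rate_def by (rule INF_greatest) (use I in \<open>simp add: rate_functions_def\<close>)
    qed
    moreover have "carrier_of K \<in> sets borel" by (intro borel_compact) simp
    ultimately show ?thesis using True by (simp add: l_meas_eq measure_return)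
  next
    case False
    have "\<infinity> \<le> l_rate I K"
      unfolding l_rate_def
    proof (rule INF_greatest)
      fix y assume "y \<in> carrier_of K"
      with False have "y \<noteq> x" by blast
      then show "\<infinity> \<le> I y" by (simp add: Iy)
    qed
    then have "l_rate I K = \<infinity>" by simp
    moreover have "carrier_of K \<in> sets borel" by (intro borel_compact) simp
    ultimately show ?thesis using False by (simp add: l_meas_eq measure_return)
  qed
  moreover have "limitin narrow_topology \<mu> (return borel x) sequentially"
  proof (rule limitin_narrow_topologyI[OF w(2) return_prob_measures])
    fix G :: "'a set" and s assume G: "open G" and s: "s < measure (return borel x) G"
    show "eventually (\<lambda>n. s < measure (\<mu> n) G) sequentially"
    proof (cases "x \<in> G")
      case True
      define p where "p = max (1 / 2) s"
      have "s < 1" using s True G by (simp add: measure_return)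
      then have p: "0 < p" "p < 1" "s \<le> p" by (auto simp: p_def)
      define t where "t = - ln p / A"
      have t: "0 < t" "exp (- A * t) = p" using A p by (auto simp: t_def intro!: divide_neg_pos)
      from mass[OF G True t(1) Ix[OF t(1)]] show ?thesis
      proof eventually_elim
        case (elim n)
        then show ?case using t(2) p(3) by linarith
      qed
    next
      case False
      then have "s < 0" using s G by (simp add: measure_return)
      then have "s < measure (\<mu> n) G" for n using measure_nonneg[of "\<mu> n" G] by linarith
      then show ?thesis by simp
    qed
  qed
  ultimately show ?thesis by blast
qed

text \<open>The limit is the image of a pair \<open>(b, \<nu>)\<close>, and the speeds converge to \<open>\<alpha>\<close>, possibly 0. The
  exponent \<open>\<alpha> / b\<close> compares the two normalizations \<open>\<mu> n (K) powr (1 / a n)\<close> and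
  \<open>\<nu> K powr (1 / b)\<close>.\<close>
context
  fixes \<mu> :: "nat \<Rightarrow> 'a::polish_space measure" and \<nu> :: "'a measure" and w a b \<alpha>
  assumes lim: "limitin L_topology w (l_meas b \<nu>) sequentially"
    and w: "\<And>n. 0 < a n" "\<And>n. \<mu> n \<in> prob_measures" "\<And>n. w n = l_meas (a n) (\<mu> n)"
    and b: "0 < b" and \<nu>: "\<nu> \<in> prob_measures" and a: "a \<longlonglongrightarrow> \<alpha>"
begin

lemma limit_speed_nonneg: "0 \<le> \<alpha>"
  using w(1) by (intro LIMSEQ_le_const[OF a]) (auto intro: less_imp_le)

lemma exp_speed_tendsto: "(\<lambda>n. exp (- a n * t)) \<longlonglongrightarrow> exp (- \<alpha> * t)"
  by (intro tendsto_intros a)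

lemma exp_speed_eq: "0 < p \<Longrightarrow> exp (- \<alpha> * (- ln p / b)) = p powr (\<alpha> / b)"
  "0 < p \<Longrightarrow> exp (- b * (- ln p / b)) = p"
  using b by (simp_all add: powr_def)

text \<open>Approximate \<open>G\<close> from inside by a compact set and pass to a recovery set inside \<open>G\<close>. The
  convention \<open>0 powr 0 = 0\<close> makes the statement right for \<open>\<alpha> = 0\<close> as well: sets of positive
  \<open>\<nu>\<close>-mass then asymptotically carry full mass, and null sets give no information.\<close>
lemma open_mass_liminf:
  assumes G: "open G" and s: "s < measure \<nu> G powr (\<alpha> / b)"
  shows "eventually (\<lambda>n. s < measure (\<mu> n) G) sequentially"
proof (cases "measure \<nu> G = 0")
  case True
  with s have "s < 0" by simp
  then have "s < measure (\<mu> n) G" for n using measure_nonneg[of "\<mu> n" G] by linarith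
  then show ?thesis by simp
next
  case False
  define m where "m = measure \<nu> G"
  have m: "0 < m" using False by (simp add: m_def zero_less_measure_iff)
  have "((\<lambda>p. p powr (\<alpha> / b)) \<longlongrightarrow> m powr (\<alpha> / b)) (at_left m)"
    using m by (intro tendsto_powr) auto
  then have "eventually (\<lambda>p. s < p powr (\<alpha> / b)) (at_left m)"
    by (rule order_tendstoD) (use s m_def in simp)
  moreover have "eventually (\<lambda>p. p \<in> {0<..<m}) (at_left m)"
    by (rule eventually_at_leftI[OF _ m]) simp
  ultimately have "eventually (\<lambda>p. s < p powr (\<alpha> / b) \<and> p \<in> {0<..<m}) (at_left m)"
    by (rule eventually_conj)
  from eventually_happens'[OF trivial_limit_at_left_real this]
  obtain p where p: "s < p powr (\<alpha> / b)" "0 < p" "p < m" by auto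
  obtain K where K: "carrier_of K \<subseteq> G" "p < measure \<nu> (carrier_of K)"
    by (rule compact_inner_approximation[OF \<nu> borel_open[OF G], of p]) (use p m_def in auto)
  define t where "t = - ln p / b"
  have t: "exp (- \<alpha> * t) = p powr (\<alpha> / b)" "exp (- b * t) = p"
    using exp_speed_eq[OF p(2)] by (simp_all only: t_def)
  have "l_meas b \<nu> K < ereal t" using K b t by (simp add: l_meas_less_iff)
  from limitin_L_recovery_compact[OF lim this G K(1)]
  obtain Q where Q: "carrier_of Q \<subseteq> G" "eventually (\<lambda>n. w n Q < ereal t) sequentially" .
  have "eventually (\<lambda>n. s < exp (- a n * t)) sequentially"
    by (rule order_tendstoD[OF exp_speed_tendsto]) (use p t in simp)
  with Q(2) show ?thesis
  proof eventually_elim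
    case (elim n)
    interpret prob_space "\<mu> n" using w by (intro prob_measuresD)
    have "exp (- a n * t) < measure (\<mu> n) (carrier_of Q)" using elim w by (simp add: l_meas_less_iff)
    also have "\<dots> \<le> measure (\<mu> n) G"
      using Q(1) prob_measures_sets[OF w(2)] G by (intro finite_measure_mono) auto
    finally show ?case using elim by linarith
  qed
qed

text \<open>The case \<open>\<alpha> = 0\<close> is excluded because \<open>p powr 0 = 1\<close> for every \<open>p > 0\<close>, however small,
  so a compact null set gets no bound better than 1.\<close>
lemma compact_mass_limsup:
  assumes \<alpha>: "0 < \<alpha>" and s: "measure \<nu> (carrier_of K) powr (\<alpha> / b) < s"
  shows "eventually (\<lambda>n. measure (\<mu> n) (carrier_of K) < s) sequentially"
proof -
  define m where "m = measure \<nu> (carrier_of K)"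
  have m: "0 \<le> m" by (simp add: m_def)
  have right: "eventually (\<lambda>p. p \<in> {m<..<m + 1}) (at_right m)"
    by (rule eventually_at_rightI[of m "m + 1"]) auto
  have "((\<lambda>p. p powr (\<alpha> / b)) \<longlongrightarrow> m powr (\<alpha> / b)) (at_right m)"
  proof (rule tendsto_powr')
    have "eventually (\<lambda>p. 0 \<le> p) (at_right m)"
      using right by eventually_elim (use m in auto)
    then show "m \<noteq> 0 \<or> (0 < \<alpha> / b \<and> eventually (\<lambda>p. 0 \<le> p) (at_right m))"
      using \<alpha> b by simp
  qed auto
  then have "eventually (\<lambda>p. p powr (\<alpha> / b) < s) (at_right m)"
    by (rule order_tendstoD) (use s m_def in simp)
  then have "eventually (\<lambda>p. p powr (\<alpha> / b) < s \<and> p \<in> {m<..<m + 1}) (at_right m)"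
    using right by (rule eventually_conj)
  from eventually_happens'[OF trivial_limit_at_right_real this]
  obtain p where p: "p powr (\<alpha> / b) < s" "m < p" by auto
  then have "0 < p" using m by simp
  define t where "t = - ln p / b"
  have t: "exp (- \<alpha> * t) = p powr (\<alpha> / b)" "exp (- b * t) = p"
    using exp_speed_eq[OF \<open>0 < p\<close>] by (simp_all only: t_def)
  have "ereal t < l_meas b \<nu> K" using p b t by (simp add: less_l_meas_iff m_def)
  from limitin_L_liminf[OF lim this]
  have "eventually (\<lambda>n. ereal t < w n K) sequentially" .
  moreover have "eventually (\<lambda>n. exp (- a n * t) < s) sequentially"
    by (rule order_tendstoD[OF exp_speed_tendsto]) (use p t in simp)
  ultimately show ?thesis
    by eventually_elim (use w in \<open>auto simp: less_l_meas_iff\<close>)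
qed

text \<open>A compact set of \<open>\<nu>\<close>-mass close to 1 has a small value under \<open>l_meas b \<nu>\<close>, and its recovery set
  then has mass close to 1 for all large \<open>n\<close> because the speeds are bounded.\<close>
lemma limit_sequence_tight:
  assumes q: "q < 1"
  obtains Q where "eventually (\<lambda>n. q < measure (\<mu> n) (carrier_of Q)) sequentially"
proof -
  define p where "p = max (1 / 2) q"
  have p: "0 < p" "p < 1" "q \<le> p" using q by (auto simp: p_def)
  \<comment> \<open>The speeds are eventually below \<open>\<alpha> + 1\<close>, which is positive even if \<open>\<alpha> = 0\<close>.\<close>
  define t where "t = - ln p / (\<alpha> + 1)"
  have t: "0 < t" "exp (- (\<alpha> + 1) * t) = p"
  proof -
    have *: "ln p < 0" "0 < \<alpha> + 1" using p limit_speed_nonneg by auto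
    then show "0 < t" by (simp add: t_def divide_neg_pos)
    have "- (\<alpha> + 1) * t = ln p" unfolding t_def using * by (simp add: field_simps)
    then show "exp (- (\<alpha> + 1) * t) = p" using p by simp
  qed
  interpret \<nu>: prob_space \<nu> using \<nu> by (rule prob_measuresD)
  have "measure \<nu> UNIV = 1" using \<nu>.prob_space prob_measuresD(3)[OF \<nu>] by simp
  then obtain K where K: "exp (- b * t) < measure \<nu> (carrier_of K)"
    by (rule_tac compact_inner_approximation[OF \<nu>, of UNIV "exp (- b * t)"]) (use b t in auto)
  have "l_meas b \<nu> K < ereal t" using K b by (simp add: l_meas_less_iff)
  from limitin_L_recovery_compact[OF lim this open_UNIV]
  obtain Q where Q: "eventually (\<lambda>n. w n Q < ereal t) sequentially" by auto
  have "eventually (\<lambda>n. a n < \<alpha> + 1) sequentially" by (rule order_tendstoD[OF a]) simp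
  with Q have "eventually (\<lambda>n. q < measure (\<mu> n) (carrier_of Q)) sequentially"
  proof eventually_elim
    case (elim n)
    have "q \<le> exp (- (\<alpha> + 1) * t)" using t p by simp
    also have "\<dots> \<le> exp (- a n * t)"
      using mult_right_mono[of "a n" "\<alpha> + 1" t] elim t(1)
      by (simp only: exp_le_cancel_iff minus_mult_left[symmetric] neg_le_iff_le less_imp_le)
    also have "\<dots> < measure (\<mu> n) (carrier_of Q)" using elim w by (simp add: l_meas_less_iff)
    finally show ?case .
  qed
  then show ?thesis by (rule that)
qed

lemma closed_mass_limsup:
  assumes \<alpha>: "0 < \<alpha>" and F: "closed F" and s: "measure \<nu> F powr (\<alpha> / b) < s"
  shows "eventually (\<lambda>n. measure (\<mu> n) F < s) sequentially"
proof -
  obtain r where r: "measure \<nu> F powr (\<alpha> / b) < r" "r < s" using dense[OF s] by blast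
  obtain Q where Q: "eventually (\<lambda>n. 1 - (s - r) < measure (\<mu> n) (carrier_of Q)) sequentially"
    by (rule limit_sequence_tight[of "1 - (s - r)"]) (use r in auto)
  interpret \<nu>: prob_space \<nu> using \<nu> by (rule prob_measuresD)
  define K where "K = Compacts (F \<inter> carrier_of Q)"
  have K: "carrier_of K = F \<inter> carrier_of Q" using F by (simp add: K_def closed_Int_compact)
  have "measure \<nu> (carrier_of K) powr (\<alpha> / b) \<le> measure \<nu> F powr (\<alpha> / b)"
    using \<alpha> b F K prob_measures_sets[OF \<nu>]
    by (intro powr_mono2 \<nu>.finite_measure_mono) auto
  then have "eventually (\<lambda>n. measure (\<mu> n) (carrier_of K) < r) sequentially"
    using r by (intro compact_mass_limsup \<alpha>) simp
  with Q show ?thesis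
  proof eventually_elim
    case (elim n)
    interpret prob_space "\<mu> n" using w by (intro prob_measuresD)
    have cQ: "closed (carrier_of Q)" by (simp add: compact_imp_closed)
    note [simp] = prob_measures_sets[OF w(2)] prob_measuresD(2,3)[OF w(2)]
    have "F \<subseteq> carrier_of K \<union> (space (\<mu> n) - carrier_of Q)" using K by auto
    then have "measure (\<mu> n) F \<le> measure (\<mu> n) (carrier_of K \<union> (space (\<mu> n) - carrier_of Q))"
      using F cQ K by (intro finite_measure_mono) auto
    also have "\<dots> \<le> measure (\<mu> n) (carrier_of K) + measure (\<mu> n) (space (\<mu> n) - carrier_of Q)"
      using F cQ K by (intro measure_Un_le) auto
    also have "\<dots> = measure (\<mu> n) (carrier_of K) + (1 - measure (\<mu> n) (carrier_of Q))"
      using cQ by (subst prob_compl) auto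
    finally show ?case using elim by linarith
  qed
qed

lemma disjoint_approximation:
  assumes B: "B \<in> sets borel" and p: "p < measure \<nu> B" and q: "q < 1 - measure \<nu> B"
  obtains G H where "open G" "open H" "G \<inter> H = {}" "p < measure \<nu> G" "q < measure \<nu> H"
proof -
  interpret \<nu>: prob_space \<nu> using \<nu> by (rule prob_measuresD)
  have "measure \<nu> (- B) = 1 - measure \<nu> B"
    using \<nu>.prob_compl[of B] B prob_measuresD(2,3)[OF \<nu>] by (simp add: Compl_eq_Diff_UNIV)
  then have q': "q < measure \<nu> (- B)" using q by simp
  obtain K where K: "carrier_of K \<subseteq> B" "p < measure \<nu> (carrier_of K)"
    using compact_inner_approximation[OF \<nu> B p] .
  obtain L where L: "carrier_of L \<subseteq> - B" "q < measure \<nu> (carrier_of L)"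
    by (rule compact_inner_approximation[OF \<nu> _ q']) (use B in auto)
  have "\<exists>G H. open G \<and> open H \<and> carrier_of K \<subseteq> G \<and> carrier_of L \<subseteq> H \<and> G \<inter> H = {}"
    by (rule t4_space) (use K L in \<open>auto simp: compact_imp_closed\<close>)
  then obtain G H where GH: "open G" "open H" "carrier_of K \<subseteq> G" "carrier_of L \<subseteq> H" "G \<inter> H = {}"
    by blast
  have "measure \<nu> (carrier_of K) \<le> measure \<nu> G" "measure \<nu> (carrier_of L) \<le> measure \<nu> H"
    using GH prob_measures_sets[OF \<nu>] by (auto intro!: \<nu>.finite_measure_mono)
  with K L GH show ?thesis by (intro that[of G H]) auto
qed

text \<open>For \<open>0 < p < 1\<close> and \<open>c = \<alpha> / b\<close>, the sum \<open>p powr c + (1 - p) powr c\<close> is greater than 1 if \<open>c < 1\<close>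
  and less than 1 if \<open>c > 1\<close>. In the first case, disjoint open sets of mass almost \<open>p\<close> and \<open>1 - p\<close>
  would asymptotically carry more than the total mass; in the second, their complements,
  which cover the space, would carry less.\<close>
lemma different_speed_imp_zero_one:
  assumes ne: "\<alpha> \<noteq> b" and B: "B \<in> sets borel"
  shows "measure \<nu> B = 0 \<or> measure \<nu> B = 1"
proof (rule ccontr)
  assume nontrivial: "\<not> (measure \<nu> B = 0 \<or> measure \<nu> B = 1)"
  define p where "p = measure \<nu> B"
  interpret \<nu>: prob_space \<nu> using \<nu> by (rule prob_measuresD)
  have p: "0 < p" "p < 1"
    using nontrivial \<nu>.prob_le_1[of B] by (auto simp: p_def zero_less_measure_iff less_le)
  define c where "c = \<alpha> / b"
  have c: "0 \<le> c" "c \<noteq> 1" using limit_speed_nonneg b ne by (auto simp: c_def)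
  have small: "eventually (\<lambda>x::real. 0 < x \<and> x < p \<and> x < 1 - p) (at_right 0)"
    by (rule eventually_at_rightI[of 0 "min p (1 - p)"]) (use p in auto)
  show False
  proof (cases "c < 1")
    case True
    have "1 < p powr c + (1 - p) powr c"
      using powr_less_mono'[of p c 1] powr_less_mono'[of "1 - p" c 1] p True by simp
    moreover have "((\<lambda>x. (p - x) powr c + (1 - p - x) powr c) \<longlongrightarrow> (p - 0) powr c + (1 - p - 0) powr c) (at_right 0)"
      using p by (intro tendsto_intros) auto
    ultimately have "eventually (\<lambda>x. 1 < (p - x) powr c + (1 - p - x) powr c) (at_right 0)"
      by (intro order_tendstoD) auto
    from eventually_happens'[OF trivial_limit_at_right_real eventually_conj[OF this small]]
    obtain x where x: "1 < (p - x) powr c + (1 - p - x) powr c" "0 < x" "x < p" "x < 1 - p" by auto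
    obtain G H where GH: "open G" "open H" "G \<inter> H = {}" "p - x < measure \<nu> G" "1 - p - x < measure \<nu> H"
      by (rule disjoint_approximation[OF B, of "p - x" "1 - p - x"]) (use x p_def in auto)
    define e where "e = ((p - x) powr c + (1 - p - x) powr c - 1) / 2"
    have e: "0 < e" using x by (simp add: e_def)
    have "(p - x) powr c \<le> measure \<nu> G powr c" "(1 - p - x) powr c \<le> measure \<nu> H powr c"
      using c GH x by (auto intro!: powr_mono2)
    then have "eventually (\<lambda>n. (p - x) powr c - e < measure (\<mu> n) G) sequentially"
      "eventually (\<lambda>n. (1 - p - x) powr c - e < measure (\<mu> n) H) sequentially"
      using e by (auto intro!: open_mass_liminf GH simp: c_def)
    then have "eventually (\<lambda>n. False) sequentially"
    proof eventually_elim
      case (elim n)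
      then show False
        using prob_measures_disjoint_le_1[OF w(2)[of n] GH(1-3)] by (simp add: e_def field_simps)
    qed
    then show False by simp
  next
    case False
    with c have c1: "1 < c" by simp
    have \<alpha>: "0 < \<alpha>" using c1 b limit_speed_nonneg by (cases "\<alpha> = 0") (auto simp: c_def)
    have "p powr c + (1 - p) powr c < 1"
      using powr_less_mono'[of p 1 c] powr_less_mono'[of "1 - p" 1 c] p c1 by simp
    moreover have "((\<lambda>x. (p + x) powr c + (1 - p + x) powr c) \<longlongrightarrow> (p + 0) powr c + (1 - p + 0) powr c) (at_right 0)"
      using p by (intro tendsto_intros) auto
    ultimately have "eventually (\<lambda>x. (p + x) powr c + (1 - p + x) powr c < 1) (at_right 0)"
      by (intro order_tendstoD) auto
    from eventually_happens'[OF trivial_limit_at_right_real eventually_conj[OF this small]]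
    obtain x where x: "(p + x) powr c + (1 - p + x) powr c < 1" "0 < x" "x < p" "x < 1 - p" by auto
    obtain G H where GH: "open G" "open H" "G \<inter> H = {}" "p - x < measure \<nu> G" "1 - p - x < measure \<nu> H"
      by (rule disjoint_approximation[OF B, of "p - x" "1 - p - x"]) (use x p_def in auto)
    define e where "e = (1 - ((p + x) powr c + (1 - p + x) powr c)) / 2"
    have e: "0 < e" using x by (simp add: e_def)
    have compl: "measure \<rho> (- U) = 1 - measure \<rho> U" if "open U" "\<rho> \<in> prob_measures" for U and \<rho> :: "'a measure"
      using prob_space.prob_compl[OF prob_measuresD(1)[OF that(2)], of U] prob_measuresD(2,3)[OF that(2)] that(1)
      by (simp add: Compl_eq_Diff_UNIV)
    have "measure \<nu> (- G) powr c \<le> (1 - p + x) powr c" "measure \<nu> (- H) powr c \<le> (p + x) powr c"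
      using c GH x by (auto intro!: powr_mono2 simp: compl[OF _ \<nu>])
    then have "eventually (\<lambda>n. measure (\<mu> n) (- G) < (1 - p + x) powr c + e) sequentially"
      "eventually (\<lambda>n. measure (\<mu> n) (- H) < (p + x) powr c + e) sequentially"
      using e GH by (auto intro!: closed_mass_limsup[OF \<alpha>] simp: c_def)
    then have "eventually (\<lambda>n. False) sequentially"
    proof eventually_elim
      case (elim n)
      then have "2 - (measure (\<mu> n) G + measure (\<mu> n) H) < 1"
        by (simp add: compl[OF GH(1) w(2)] compl[OF GH(2) w(2)] e_def field_simps)
      then show False
        using prob_measures_disjoint_le_1[OF w(2)[of n] GH(1-3)] by linarith
    qed
    then show False by simp
  qed
qed

text \<open>Either \<open>\<alpha> / b = 1\<close>, or \<open>\<nu>\<close> only takes the values 0 and 1; both make the exponent disappear.\<close>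
lemma bounded_speed_measure_limit:
  shows "\<alpha> = b \<or> (\<exists>x. \<nu> = return borel x)"
    and "open G \<Longrightarrow> s < measure \<nu> G \<Longrightarrow> eventually (\<lambda>n. s < measure (\<mu> n) G) sequentially"
proof -
  show "\<alpha> = b \<or> (\<exists>x. \<nu> = return borel x)"
    using zero_one_measure_is_Dirac[OF \<nu>] different_speed_imp_zero_one by blast
  assume G: "open G" and s: "s < measure \<nu> G"
  have "measure \<nu> G powr (\<alpha> / b) = measure \<nu> G"
  proof (cases "\<alpha> = b")
    case True
    then show ?thesis using b by simp
  next
    case False
    from different_speed_imp_zero_one[OF this borel_open[OF G]] show ?thesis by auto
  qed
  with G s show "eventually (\<lambda>n. s < measure (\<mu> n) G) sequentially"
    by (intro open_mass_liminf) simp_all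
qed

end

lemma eventually_sequentially_subseqI:
  assumes "\<And>r::nat \<Rightarrow> nat. strict_mono r \<Longrightarrow> \<exists>n. P (r n)"
  shows "eventually P sequentially"
  using assms not_eventually_sequentiallyD by blast

text \<open>Every subsequence has a further one along which the speeds converge, and the conclusions drawn along
  it depend only on \<open>b\<close> and \<open>\<nu>\<close>.\<close>
lemma bounded_speed_limit_in_U:
  fixes \<mu> :: "nat \<Rightarrow> 'a::polish_space measure"
  assumes lim: "limitin L_topology w (l_meas b \<nu>) sequentially"
    and w: "\<And>n. 0 < a n" "\<And>n. \<mu> n \<in> prob_measures" "\<And>n. w n = l_meas (a n) (\<mu> n)"
    and b: "0 < b" and \<nu>: "\<nu> \<in> prob_measures" and bdd: "bounded (range a)"
  shows "limitin narrow_topology \<mu> \<nu> sequentially" and "a \<longlonglongrightarrow> b \<or> (\<exists>x. \<nu> = return borel x)"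
proof -
  have sub: "\<exists>k \<alpha>. strict_mono k \<and> (a \<circ> r \<circ> k) \<longlonglongrightarrow> \<alpha> \<and> (\<alpha> = b \<or> (\<exists>x. \<nu> = return borel x)) \<and>
      (\<forall>G s. open G \<longrightarrow> s < measure \<nu> G \<longrightarrow> eventually (\<lambda>n. s < measure (\<mu> (r (k n))) G) sequentially)"
    if r: "strict_mono r" for r :: "nat \<Rightarrow> nat"
  proof -
    have "bounded (range (a \<circ> r))" using bdd by (rule bounded_subset) auto
    then obtain \<alpha> k where k: "strict_mono k" "(a \<circ> r \<circ> k) \<longlonglongrightarrow> \<alpha>"
      using bounded_imp_convergent_subsequence[of "a \<circ> r"] by blast
    have "limitin L_topology (w \<circ> r \<circ> k) (l_meas b \<nu>) sequentially"
      by (intro limitin_subsequence k r lim)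
    note * = bounded_speed_measure_limit[OF this _ _ _ b \<nu> k(2), of "\<mu> \<circ> r \<circ> k"]
    have "\<alpha> = b \<or> (\<exists>x. \<nu> = return borel x)" by (rule *(1)) (use w in auto)
    moreover have "eventually (\<lambda>n. s < measure (\<mu> (r (k n))) G) sequentially"
      if "open G" "s < measure \<nu> G" for G s
      using *(2)[OF _ _ _ that] w by auto
    ultimately show ?thesis using k by blast
  qed
  show "limitin narrow_topology \<mu> \<nu> sequentially"
  proof (rule limitin_narrow_topologyI[OF w(2) \<nu>], rule eventually_sequentially_subseqI)
    fix G s and r :: "nat \<Rightarrow> nat"
    assume G: "open G" "s < measure \<nu> G" and r: "strict_mono r"
    from sub[OF r] G obtain k :: "nat \<Rightarrow> nat"
      where "eventually (\<lambda>n. s < measure (\<mu> (r (k n))) G) sequentially" by blast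
    then show "\<exists>n. s < measure (\<mu> (r n)) G" by (auto simp: eventually_sequentially)
  qed
  show "a \<longlonglongrightarrow> b \<or> (\<exists>x. \<nu> = return borel x)"
  proof (rule disjCI)
    assume nD: "\<not> (\<exists>x. \<nu> = return borel x)"
    show "a \<longlonglongrightarrow> b"
    proof (rule topological_tendstoI, rule eventually_sequentially_subseqI)
      fix S and r :: "nat \<Rightarrow> nat" assume S: "open S" "b \<in> S" and r: "strict_mono r"
      from sub[OF r] nD obtain k where "(a \<circ> r \<circ> k) \<longlonglongrightarrow> b" by blast
      from topological_tendstoD[OF this S] show "\<exists>n. a (r n) \<in> S"
        by (auto simp: eventually_sequentially)
    qed
  qed
qed

theorem bounded_speed_limit:
  fixes \<mu> :: "nat \<Rightarrow> 'a::polish_space measure"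
  assumes lim: "limitin L_topology w l sequentially" and l: "l \<in> W_space"
    and w: "\<And>n. 0 < a n" "\<And>n. \<mu> n \<in> prob_measures" "\<And>n. w n = l_meas (a n) (\<mu> n)"
    and bdd: "bounded (range a)" and inf: "(INF K. l K) = 0"
  shows "\<exists>a_lim \<mu>_lim. 0 < a_lim \<and> \<mu>_lim \<in> prob_measures \<and> l = l_meas a_lim \<mu>_lim \<and>
     limitin narrow_topology \<mu> \<mu>_lim sequentially \<and> (a \<longlonglongrightarrow> a_lim \<or> (\<exists>x. \<mu>_lim = return borel x))"
proof (cases "l \<in> U_space")
  case True
  then obtain b \<nu> where *: "0 < b" "\<nu> \<in> prob_measures" "l = l_meas b \<nu>" by (auto simp: U_space_def)
  from bounded_speed_limit_in_U[OF lim[unfolded *(3)] w *(1,2) bdd] show ?thesis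
    by (intro exI[of _ b] exI[of _ \<nu>] conjI *)
next
  case False
  with l obtain I where I: "I \<in> rate_functions" "l = l_rate I" by (auto simp: W_space_def V_space_def)
  obtain A where A: "\<And>n. a n \<le> A" using bdd by (auto simp: bounded_iff abs_le_iff)
  obtain x where "l_rate I = l_meas 1 (return borel x)" "limitin narrow_topology \<mu> (return borel x) sequentially"
    using bounded_speed_rate_limit_is_Dirac[OF lim[unfolded I(2)] I(1) inf[unfolded I(2)] w A] by blast
  with I(2) show ?thesis
    by (intro exI[of _ "1::real"] exI[of _ "return borel x"] conjI return_prob_measures) auto
qed

section \<open>Metrizability on equicoercive sets\<close>

text \<open>An injective continuous map is an embedding as soon as its inverse is continuous, and for a
  generated topology this need only be tested on the generating sets.\<close>
lemma metrizable_space_if_separated: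
  assumes X: "X = topology_generated_by S" and Y: "metrizable_space Y"
    and cont: "continuous_map X Y h" and inj: "inj_on h (topspace X)"
    and sep: "\<And>U x. U \<in> S \<Longrightarrow> x \<in> U \<Longrightarrow>
      \<exists>V. openin Y V \<and> h x \<in> V \<and> (\<forall>y\<in>topspace X. h y \<in> V \<longrightarrow> y \<in> U)"
  shows "metrizable_space X"
proof -
  define Z where "Z = subtopology Y (h ` topspace X)"
  define g where "g = inv_into (topspace X) h"
  have hY: "h ` topspace X \<subseteq> topspace Y" using continuous_map_image_subset_topspace[OF cont] .
  then have tZ: "topspace Z = h ` topspace X" by (auto simp: Z_def)
  have g: "g (h x) = x" if "x \<in> topspace X" for x using inj that by (simp add: g_def)
  have hcont: "continuous_map X Z h"
    unfolding Z_def using cont by (intro continuous_map_into_subtopology) auto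
  have "continuous_map Z (topology_generated_by S) g"
  proof (rule continuous_on_generated_topo)
    show "g ` topspace Z \<subseteq> \<Union>S"
    proof
      fix y assume "y \<in> g ` topspace Z"
      with g tZ have "y \<in> topspace X" by auto
      with X show "y \<in> \<Union>S" by simp
    qed
    fix U assume U: "U \<in> S"
    show "openin Z (g -` U \<inter> topspace Z)"
    proof (subst openin_subopen, intro ballI)
      fix z assume z: "z \<in> g -` U \<inter> topspace Z"
      then obtain x where x: "x \<in> topspace X" "z = h x" using tZ by auto
      with z g have "x \<in> U" by auto
      from sep[OF U this] obtain V where V: "openin Y V" "h x \<in> V" "\<forall>y\<in>topspace X. h y \<in> V \<longrightarrow> y \<in> U"
        by blast
      show "\<exists>T. openin Z T \<and> z \<in> T \<and> T \<subseteq> g -` U \<inter> topspace Z"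
      proof (intro exI[of _ "V \<inter> h ` topspace X"] conjI)
        show "openin Z (V \<inter> h ` topspace X)" unfolding Z_def using V by (auto simp: openin_subtopology)
        show "V \<inter> h ` topspace X \<subseteq> g -` U \<inter> topspace Z" using V g tZ by auto
      qed (use V x in auto)
    qed
  qed
  then have "homeomorphic_maps X Z h g"
    unfolding homeomorphic_maps_def using hcont g tZ X by auto
  then have "X homeomorphic_space Z" by (rule homeomorphic_maps_imp_homeomorphic_space)
  moreover have "metrizable_space Z" unfolding Z_def using Y by (rule metrizable_space_subtopology)
  ultimately show ?thesis using homeomorphic_metrizable_space by blast
qed

text \<open>The radius \<open>r\<close> at which the decreasing function \<open>r \<mapsto> l(enlargement r F)\<close>, an infimum over
  compact subsets, falls below the increasing function \<open>t + r\<close>, cut off at 1. The slope is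
  essential: the radius at which a constant level is crossed would jump where the
  decreasing function is flat. The cut-off keeps the set nonempty and the value real.\<close>
definition crossing_radius :: "'a::metric_space set \<Rightarrow> real \<Rightarrow> ('a compacts \<Rightarrow> ereal) \<Rightarrow> real" where
  "crossing_radius F t l =
     Inf {r. 0 < r \<and> (1 \<le> r \<or> (\<exists>K. carrier_of K \<subseteq> enlargement r F \<and> l K < ereal (t + r)))}"

lemma crossing_radius_bounds: "0 \<le> crossing_radius F t l" "crossing_radius F t l \<le> 1"
proof -
  let ?A = "{r. 0 < r \<and> (1 \<le> r \<or> (\<exists>K. carrier_of K \<subseteq> enlargement r F \<and> l K < ereal (t + r)))}"
  have A: "1 \<in> ?A" "bdd_below ?A" by (auto intro: bdd_belowI[of _ 0])
  show "crossing_radius F t l \<le> 1" unfolding crossing_radius_def by (rule cInf_lower[OF A])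
  show "0 \<le> crossing_radius F t l"
    unfolding crossing_radius_def
  proof (rule cInf_greatest)
    show "?A \<noteq> {}" using A(1) by blast
  qed simp
qed

lemma crossing_radius_less_iff:
  assumes "s \<le> 1"
  shows "crossing_radius F t l < s \<longleftrightarrow>
    (\<exists>r>0. r < s \<and> (\<exists>K. carrier_of K \<subseteq> enlargement r F \<and> l K < ereal (t + r)))"
proof -
  let ?A = "{r. 0 < r \<and> (1 \<le> r \<or> (\<exists>K. carrier_of K \<subseteq> enlargement r F \<and> l K < ereal (t + r)))}"
  have "1 \<in> ?A" "bdd_below ?A" by (auto intro: bdd_belowI[of _ 0])
  then have "crossing_radius F t l < s \<longleftrightarrow> (\<exists>r\<in>?A. r < s)"
    unfolding crossing_radius_def by (intro cInf_less_iff) blast+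
  then show ?thesis using assms by auto
qed

text \<open>Being smaller than \<open>a\<close> is witnessed by one compact set inside an open enlargement, an open
  condition on \<open>l\<close>. Being larger than \<open>a\<close> leaves room for two radii \<open>a < r0 < r1\<close> below the
  crossing radius; as \<open>t + r0 < t + r1\<close>, the value of \<open>l\<close> on the closure of the smaller enlargement,
  compact because \<open>X\<close> is, exceeds \<open>t + r0\<close>, which is open and keeps the crossing radius at least \<open>r0\<close>.\<close>
lemma continuous_map_crossing_radius:
  fixes F :: "'a::metric_space set"
  assumes cpt: "compact (UNIV :: 'a set)"
  shows "continuous_map L_topology euclideanreal (crossing_radius F t)"
  unfolding continuous_map_upper_lower_semicontinuous_lt
proof (intro conjI allI)
  fix a :: real
  show "openin L_topology {l \<in> topspace L_topology. crossing_radius F t l < a}"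
  proof (cases "a \<le> 1")
    case True
    define W where "W r = {l \<in> L_space. \<exists>K. carrier_of K \<subseteq> enlargement r F \<and> l K < ereal (t + r)}" for r
    have "l \<in> L_space \<and> crossing_radius F t l < a \<longleftrightarrow> (\<exists>r. 0 < r \<and> r < a \<and> l \<in> W r)" for l
      unfolding crossing_radius_less_iff[OF True] W_def mem_Collect_eq by metis
    then have "{l \<in> topspace L_topology. crossing_radius F t l < a} = (\<Union>r\<in>{0<..<a}. W r)"
      unfolding topspace_L_topology_eq by auto
    moreover have "openin L_topology (W r)" for r
      unfolding W_def by (intro openin_L_topology_below open_enlargement)
    then have "openin L_topology (\<Union>r\<in>{0<..<a}. W r)" by (intro openin_Union) auto
    ultimately show ?thesis by simp
  next
    case False
    then have "{l \<in> topspace L_topology. crossing_radius F t l < a} = topspace L_topology"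
      by (auto intro: le_less_trans[OF crossing_radius_bounds(2)])
    then show ?thesis by (metis openin_topspace)
  qed
  show "openin L_topology {l \<in> topspace L_topology. a < crossing_radius F t l}"
  proof (cases "a < 0")
    case True
    then have "{l \<in> topspace L_topology. a < crossing_radius F t l} = topspace L_topology"
      by (auto intro: less_le_trans[OF _ crossing_radius_bounds(1)])
    then show ?thesis by (metis openin_topspace)
  next
    case False
    show ?thesis
    proof (subst openin_subopen, intro ballI)
      fix l assume "l \<in> {l \<in> topspace L_topology. a < crossing_radius F t l}"
      then have l: "l \<in> L_space" and al: "a < crossing_radius F t l"
        unfolding topspace_L_topology_eq by auto
      obtain r1 where r1: "a < r1" "r1 < crossing_radius F t l" using dense[OF al] by blast
      obtain r0 where r0: "a < r0" "r0 < r1" using dense[OF r1(1)] by blast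
      have le1: "crossing_radius F t l \<le> 1" by (rule crossing_radius_bounds)
      define K where "K = Compacts (closure (enlargement r0 F))"
      have K: "carrier_of K = closure (enlargement r0 F)"
        unfolding K_def using cpt compact_Int_closed[OF cpt closed_closure] by (intro carrier_of_Compacts) simp
      have "carrier_of K \<subseteq> enlargement r1 F"
      proof
        fix x assume "x \<in> carrier_of K"
        then obtain y where y: "y \<in> enlargement r0 F" "dist y x < r1 - r0"
          unfolding K closure_approachable using r0 by (meson diff_gt_0_iff_gt)
        then obtain z where "z \<in> F" "dist z y < r0" by (auto simp: enlargement_def)
        then show "x \<in> enlargement r1 F"
          using y dist_triangle[of z x y] by (auto simp: enlargement_def intro!: bexI[of _ z])
      qed
      have big: "\<not> l K < ereal (t + r1)"
      proof
        assume "l K < ereal (t + r1)"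
        obtain s where s: "r1 < s" "s < crossing_radius F t l" using dense[OF r1(2)] by blast
        then have "crossing_radius F t l < s"
          using \<open>carrier_of K \<subseteq> enlargement r1 F\<close> \<open>l K < ereal (t + r1)\<close> r1 False le1
          by (subst crossing_radius_less_iff) (simp, intro exI[of _ r1] conjI exI[of _ K], auto)
        with s show False by simp
      qed
      have "ereal (t + r0) < ereal (t + r1)" using r0 by simp
      also have "\<dots> \<le> l K" using big by (simp only: not_less)
      finally have lK: "ereal (t + r0) < l K" .
      show "\<exists>T. openin L_topology T \<and> l \<in> T \<and> T \<subseteq> {l \<in> topspace L_topology. a < crossing_radius F t l}"
      proof (intro exI[of _ "{l \<in> L_space. ereal (t + r0) < l K}"] conjI subsetI)
        show "openin L_topology {l \<in> L_space. ereal (t + r0) < l K}" by (rule openin_L_topology_above)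
        show "l \<in> {l \<in> L_space. ereal (t + r0) < l K}" using l lK by simp
        fix l' assume "l' \<in> {l \<in> L_space. ereal (t + r0) < l K}"
        then have l': "l' \<in> L_space" "ereal (t + r0) < l' K" by auto
        have "\<not> crossing_radius F t l' < r0"
        proof
          assume "crossing_radius F t l' < r0"
          then obtain r P where r: "0 < r" "r < r0" "carrier_of P \<subseteq> enlargement r F" "l' P < ereal (t + r)"
            using crossing_radius_less_iff[of r0 F t l'] r0 r1 le1 by auto
          have "enlargement r F \<subseteq> carrier_of K"
            unfolding K using enlargement_mono[of r r0 F] r closure_subset by (meson less_imp_le order_trans)
          then have "l' K \<le> l' P" using r by (intro L_space_antimono l') auto
          then have "ereal (t + r0) < ereal (t + r)" using l' r by (meson less_le_trans less_trans)
          then show False using r by simp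
        qed
        then show "l' \<in> {l \<in> topspace L_topology. a < crossing_radius F t l}"
          using l' r0 unfolding topspace_L_topology_eq by auto
      qed
    qed
  qed
qed

lemma finite_approximation:
  assumes D: "\<forall>X. open X \<longrightarrow> X \<noteq> {} \<longrightarrow> (\<exists>d\<in>D. d \<in> X)" and K: "compact K" and \<delta>: "0 < \<delta>"
  obtains F where "finite F" "F \<subseteq> D" "K \<subseteq> enlargement \<delta> F" "F \<subseteq> enlargement \<delta> K"
proof -
  have "K \<subseteq> (\<Union>d\<in>D \<inter> enlargement \<delta> K. ball d \<delta>)"
  proof
    fix x assume x: "x \<in> K"
    obtain d where "d \<in> D" "d \<in> ball x \<delta>" using D[rule_format, of "ball x \<delta>"] \<delta> by auto
    then show "x \<in> (\<Union>d\<in>D \<inter> enlargement \<delta> K. ball d \<delta>)"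
      using x by (auto simp: enlargement_def dist_commute intro!: bexI[of _ d])
  qed
  then obtain F where "F \<subseteq> D \<inter> enlargement \<delta> K" "finite F" "K \<subseteq> (\<Union>d\<in>F. ball d \<delta>)"
    by (rule compactE_image[OF K, rotated]) auto
  then show ?thesis by (intro that[of F]) (auto simp: enlargement_def)
qed

lemma enlargement_enlargement:
  assumes "A \<subseteq> enlargement \<delta> B"
  shows "enlargement r A \<subseteq> enlargement (r + \<delta>) B"
proof
  fix x assume "x \<in> enlargement r A"
  then obtain y where y: "y \<in> A" "dist y x < r" by (auto simp: enlargement_def)
  then obtain z where z: "z \<in> B" "dist z y < \<delta>" using assms by (auto simp: enlargement_def)
  then show "x \<in> enlargement (r + \<delta>) B"
    using y dist_triangle[of z x y] by (auto simp: enlargement_def intro!: bexI[of _ z])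
qed

text \<open>Crossing radii see the lower bounds \<open>l K > t0\<close>, uniformly over the compact sets near \<open>K\<close>. The
  uniformity is what is needed to treat infima over compact families. Countably many pairs \<open>(F, t)\<close>
  suffice, with \<open>F\<close> a finite subset of a dense set and \<open>t\<close> rational.\<close>
lemma crossing_radius_detects_above:
  assumes D: "\<forall>X. open X \<longrightarrow> X \<noteq> {} \<longrightarrow> (\<exists>d\<in>D. d \<in> X)"
    and l: "l \<in> L_space" and t0: "ereal t0 < l K"
  obtains F t \<delta> where "finite F" "F \<subseteq> D" "t \<in> \<rat>" "carrier_of K \<subseteq> enlargement \<delta> F"
    "\<delta> < crossing_radius F t l"
    "\<And>l' P. \<delta> < crossing_radius F t l' \<Longrightarrow> carrier_of P \<subseteq> enlargement \<delta> F \<Longrightarrow> ereal t0 < l' P"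
proof -
  obtain t1 where "ereal t0 < ereal t1" and t1: "ereal t1 < l K" using ereal_dense2[OF t0] by blast
  then have "t0 < t1" by simp
  obtain G where G: "open G" "carrier_of K \<subseteq> G" "\<And>P. carrier_of P \<subseteq> G \<Longrightarrow> ereal t1 < l P"
    by (rule L_space_outer[OF l t1]) (rule that)
  obtain \<epsilon> where \<epsilon>: "0 < \<epsilon>" "enlargement \<epsilon> (carrier_of K) \<subseteq> G"
    by (rule compact_enlargement_subset[OF compact_carrier_of G(1,2)])
  obtain t where t: "t \<in> \<rat>" "t0 < t" "t < t1" using Rats_dense_in_real[OF \<open>t0 < t1\<close>] by blast
  \<comment> \<open>Enlarging \<open>F\<close> by \<open>2 * \<delta>\<close> must stay within \<open>\<epsilon>\<close> of \<open>K\<close>, the line must stay below \<open>t1\<close> up to the radius \<open>2 * \<delta>\<close>, and this radius must not exceed the cut-off 1.\<close>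
  define \<delta> where "\<delta> = min (\<epsilon> / 3) (min ((t1 - t) / 2) (1 / 2))"
  have "\<delta> \<le> \<epsilon> / 3" "\<delta> \<le> (t1 - t) / 2" "\<delta> \<le> 1 / 2" 
    unfolding \<delta>_def by (rule min.cobounded1 min.coboundedI2[OF min.cobounded1] min.coboundedI2[OF min.cobounded2])+
  moreover have "0 < \<delta>" using \<epsilon> t by (simp add: \<delta>_def)
  ultimately have \<delta>: "0 < \<delta>" "2 * \<delta> + \<delta> \<le> \<epsilon>" "t + 2 * \<delta> \<le> t1" "2 * \<delta> \<le> 1" by auto
  obtain F where F: "finite F" "F \<subseteq> D" "carrier_of K \<subseteq> enlargement \<delta> F" "F \<subseteq> enlargement \<delta> (carrier_of K)"
    by (rule finite_approximation[OF D compact_carrier_of \<delta>(1)])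
  have "\<not> crossing_radius F t l < 2 * \<delta>"
  proof
    assume "crossing_radius F t l < 2 * \<delta>"
    then obtain r P where r: "r < 2 * \<delta>" "carrier_of P \<subseteq> enlargement r F" "l P < ereal (t + r)"
      unfolding crossing_radius_less_iff[OF \<delta>(4)] by blast
    have "enlargement r F \<subseteq> enlargement (r + \<delta>) (carrier_of K)" by (rule enlargement_enlargement[OF F(4)])
    also have "\<dots> \<subseteq> enlargement \<epsilon> (carrier_of K)" using r \<delta> by (intro enlargement_mono) simp
    finally have "ereal t1 < l P" using r \<epsilon> by (intro G(3)) blast
    then have "ereal t1 < ereal (t + r)" using r(3) by (rule less_trans)
    then show False using r \<delta> by simp
  qed
  show ?thesis
  proof (rule that[of F t \<delta>])
    show "\<delta> < crossing_radius F t l" using \<open>\<not> crossing_radius F t l < 2 * \<delta>\<close> \<delta>(1) by linarith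
    fix l' :: "'a compacts \<Rightarrow> ereal" and P
    assume *: "\<delta> < crossing_radius F t l'" "carrier_of P \<subseteq> enlargement \<delta> F"
    show "ereal t0 < l' P"
    proof (rule ccontr)
      assume "\<not> ereal t0 < l' P"
      then have "l' P \<le> ereal t0" by (simp only: not_less)
      also have "\<dots> < ereal (t + \<delta>)" using t \<delta> by simp
      finally have "l' P < ereal (t + \<delta>)" .
      obtain s where s: "\<delta> < s" "s < crossing_radius F t l'" using dense[OF *(1)] by blast
      then have "s \<le> 1" using crossing_radius_bounds(2)[of F t l'] by linarith
      then have "crossing_radius F t l' < s"
        unfolding crossing_radius_less_iff[OF \<open>s \<le> 1\<close>] using \<open>l' P < ereal (t + \<delta>)\<close> * s \<delta> by blast
      with s show False by simp
    qed
  qed (use F t in auto)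
qed

text \<open>The counterpart for upper bounds: a small crossing radius provides a compact set
  within the corresponding enlargement of \<open>F\<close>, hence within \<open>G\<close>, on which the functional is below \<open>t0\<close>.\<close>
lemma crossing_radius_detects_below:
  assumes D: "\<forall>X. open X \<longrightarrow> X \<noteq> {} \<longrightarrow> (\<exists>d\<in>D. d \<in> X)"
    and t0: "l K < ereal t0" and G: "open G" "carrier_of K \<subseteq> G"
  obtains F t \<delta> where "finite F" "F \<subseteq> D" "t \<in> \<rat>" "crossing_radius F t l < \<delta>"
    "\<And>l'. crossing_radius F t l' < \<delta> \<Longrightarrow> \<exists>P. carrier_of P \<subseteq> G \<and> l' P < ereal t0"
proof -
  obtain t1 where t1: "l K < ereal t1" "ereal t1 < ereal t0" using ereal_dense2[OF t0] by blast
  obtain \<epsilon> where \<epsilon>: "0 < \<epsilon>" "enlargement \<epsilon> (carrier_of K) \<subseteq> G"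
    by (rule compact_enlargement_subset[OF compact_carrier_of G])
  obtain t where t: "t \<in> \<rat>" "t1 < t" "t < t0" using Rats_dense_in_real[of t1 t0] t1(2) by auto
  define \<delta> where "\<delta> = min (\<epsilon> / 3) (min ((t0 - t) / 2) (1 / 2))"
  have "\<delta> \<le> \<epsilon> / 3" "\<delta> \<le> (t0 - t) / 2" "\<delta> \<le> 1 / 2" 
    unfolding \<delta>_def by (rule min.cobounded1 min.coboundedI2[OF min.cobounded1] min.coboundedI2[OF min.cobounded2])+
  moreover have "0 < \<delta>" using \<epsilon> t by (simp add: \<delta>_def)
  ultimately have \<delta>: "0 < \<delta>" "2 * \<delta> + \<delta> \<le> \<epsilon>" "t + 2 * \<delta> \<le> t0" "2 * \<delta> \<le> 1" by auto
  obtain F where F: "finite F" "F \<subseteq> D" "carrier_of K \<subseteq> enlargement \<delta> F" "F \<subseteq> enlargement \<delta> (carrier_of K)"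
    by (rule finite_approximation[OF D compact_carrier_of \<delta>(1)])
  show ?thesis
  proof (rule that[of F t "2 * \<delta>"])
    have "ereal t1 < ereal (t + \<delta>)" using t \<delta> by simp
    with t1(1) have "l K < ereal (t + \<delta>)" by (rule less_trans)
    then show "crossing_radius F t l < 2 * \<delta>"
      unfolding crossing_radius_less_iff[OF \<delta>(4)] using F \<delta> by (intro exI[of _ \<delta>]) auto
    fix l' :: "'a compacts \<Rightarrow> ereal" assume "crossing_radius F t l' < 2 * \<delta>"
    then obtain r P where r: "r < 2 * \<delta>" "carrier_of P \<subseteq> enlargement r F" "l' P < ereal (t + r)"
      unfolding crossing_radius_less_iff[OF \<delta>(4)] by blast
    have "enlargement r F \<subseteq> enlargement (r + \<delta>) (carrier_of K)" by (rule enlargement_enlargement[OF F(4)])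
    also have "\<dots> \<subseteq> enlargement \<epsilon> (carrier_of K)" using r \<delta> by (intro enlargement_mono) simp
    finally have "carrier_of P \<subseteq> G" using r \<epsilon> by blast
    moreover have "ereal (t + r) < ereal t0" using r \<delta> by simp
    with r(3) have "l' P < ereal t0" by (rule less_trans)
    ultimately show "\<exists>P. carrier_of P \<subseteq> G \<and> l' P < ereal t0" by blast
  qed (use F t in auto)
qed

text \<open>The crossing radii for finite subsets of a countable dense set and rational levels are countably
  many continuous functions. They recover both kinds of generating sets of the topology and
  separate points, so they embed the space into a countable product of lines.\<close>
lemma metrizable_L_topology:
  assumes cpt: "compact (UNIV :: 'a::polish_space set)"
  shows "metrizable_space (L_topology :: ('a compacts \<Rightarrow> ereal) topology)"
proof -
  obtain D :: "'a set" where "countable D" and D: "\<forall>X. open X \<longrightarrow> X \<noteq> {} \<longrightarrow> (\<exists>d\<in>D. d \<in> X)"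
    using countable_dense_exists by blast
  define J where "J = {F. F \<subseteq> D \<and> finite F} \<times> (\<rat> :: real set)"
  have J: "countable J" "J \<noteq> {}"
    unfolding J_def using countable_Collect_finite_subset[OF \<open>countable D\<close>] countable_rat
    by (auto intro!: countable_SIGMA simp: conj_commute)
  define e where "e = from_nat_into J"
  have e: "\<exists>n. e n = j" if "j \<in> J" for j
    using that J by (metis e_def from_nat_into_surj)
  define h :: "('a compacts \<Rightarrow> ereal) \<Rightarrow> nat \<Rightarrow> real"
    where "h l n = crossing_radius (fst (e n)) (snd (e n)) l" for l n
  have above: "\<exists>n \<delta> N. open N \<and> K \<in> N \<and> \<delta> < h l n \<and> (\<forall>l'. \<delta> < h l' n \<longrightarrow> (\<forall>P\<in>N. ereal t0 < l' P))"
    if l: "l \<in> L_space" "ereal t0 < l K" for l K t0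
  proof -
    obtain F t \<delta> where F: "finite F" "F \<subseteq> D" "t \<in> \<rat>" "carrier_of K \<subseteq> enlargement \<delta> F"
      "\<delta> < crossing_radius F t l"
      "\<And>l' P. \<delta> < crossing_radius F t l' \<Longrightarrow> carrier_of P \<subseteq> enlargement \<delta> F \<Longrightarrow> ereal t0 < l' P"
      by (rule crossing_radius_detects_above[OF D l]) (rule that)
    then obtain n where n: "e n = (F, t)" using e[of "(F, t)"] by (auto simp: J_def)
    show ?thesis
      by (intro exI[of _ n] exI[of _ \<delta>] exI[of _ "{P. carrier_of P \<subseteq> enlargement \<delta> F}"] conjI
          open_compacts_inside open_enlargement) (use F n in \<open>auto simp: h_def\<close>)
  qed
  have below: "\<exists>n \<delta>. h l n < \<delta> \<and> (\<forall>l'\<in>L_space. h l' n < \<delta> \<longrightarrow> (INF P\<in>U. l' P) < ereal t0)"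
    if U: "open U" and t0: "(INF K\<in>U. l K) < ereal t0" for l U t0
  proof -
    obtain K where K: "K \<in> U" "l K < ereal t0" using t0 by (auto simp: INF_less_iff)
    obtain \<epsilon> where \<epsilon>: "0 < \<epsilon>" "\<And>K'. hausdorff_distance K K' < ereal \<epsilon> \<Longrightarrow> K' \<in> U"
      using U K(1) unfolding open_compacts_def by blast
    let ?G = "enlargement (\<epsilon> / 2) (carrier_of K)"
    have KG: "carrier_of K \<subseteq> ?G" using \<epsilon> by (simp add: subset_enlargement)
    obtain F t \<delta> where F: "finite F" "F \<subseteq> D" "t \<in> \<rat>" "crossing_radius F t l < \<delta>"
      "\<And>l'. crossing_radius F t l' < \<delta> \<Longrightarrow> \<exists>P. carrier_of P \<subseteq> ?G \<and> l' P < ereal t0"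
      by (rule crossing_radius_detects_below[where K = K and G = ?G and l = l, OF D K(2) open_enlargement KG]) (rule that)
    then obtain n where n: "e n = (F, t)" using e[of "(F, t)"] by (auto simp: J_def)
    have "(INF P\<in>U. l' P) < ereal t0" if l': "l' \<in> L_space" "h l' n < \<delta>" for l'
    proof -
      obtain P where P: "carrier_of P \<subseteq> ?G" "l' P < ereal t0" using F(5)[of l'] l' n by (auto simp: h_def)
      define P' where "P' = Compacts (carrier_of P \<union> carrier_of K)"
      have P': "carrier_of P' = carrier_of P \<union> carrier_of K" by (simp add: P'_def compact_Un)
      have "P' \<in> U"
      proof (intro \<epsilon>(2) hausdorff_distance_lessI[of "\<epsilon> / 2"])
        show "carrier_of K \<subseteq> enlargement (\<epsilon> / 2) (carrier_of P')"
          using subset_enlargement[of "\<epsilon> / 2" "carrier_of P'"] \<epsilon> P' by auto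
        show "carrier_of P' \<subseteq> ?G" using P KG P' by auto
      qed (use \<epsilon> in auto)
      have "l' P' \<le> l' P" using P' by (intro L_space_antimono l') auto
      with P have "l' P' < ereal t0" by simp
      with \<open>P' \<in> U\<close> show ?thesis by (auto simp: INF_less_iff)
    qed
    then show ?thesis using F(4) n by (intro exI[of _ n] exI[of _ \<delta>]) (auto simp: h_def)
  qed
  show ?thesis
  proof (rule metrizable_space_if_separated[OF L_topology_def])
    show "metrizable_space (euclidean :: (nat \<Rightarrow> real) topology)" by (rule metrizable_space_euclidean)
    show "continuous_map L_topology euclidean h"
      unfolding euclidean_product_topology[symmetric] continuous_map_componentwise_UNIV h_def
      using continuous_map_crossing_radius[OF cpt] by blast
    show "inj_on h (topspace L_topology)"
    proof (rule inj_onI, rule ext)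
      fix l l' :: "'a compacts \<Rightarrow> ereal" and K
      assume "l \<in> topspace L_topology" "l' \<in> topspace L_topology" and h: "h l = h l'"
      then have L: "l \<in> L_space" "l' \<in> L_space" by (simp_all add: topspace_L_topology_eq)
      have False if "f \<in> L_space" "h f = h g" "g K < f K" for f g
      proof -
        obtain t where t: "g K < ereal t" "ereal t < f K" using ereal_dense2[OF \<open>g K < f K\<close>] by blast
        obtain n \<delta> N where "K \<in> N" "\<delta> < h f n" "\<forall>l'. \<delta> < h l' n \<longrightarrow> (\<forall>P\<in>N. ereal t < l' P)"
          using above[OF \<open>f \<in> L_space\<close> t(2)] by blast
        then have "ereal t < g K" using \<open>h f = h g\<close> by simp
        with t(1) show False by simp
      qed
      then show "l K = l' K" using L h by (metis linorder_neq_iff)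
    qed
    fix W and l :: "'a compacts \<Rightarrow> ereal"
    assume W: "W \<in> {{l \<in> L_space. (INF K\<in>U. l K) < ereal t} | U t. open U} \<union>
      {{l \<in> L_space. (INF K\<in>C. l K) > ereal t} | C t. compact C}" and lW: "l \<in> W"
    show "\<exists>V. openin euclidean V \<and> h l \<in> V \<and> (\<forall>l'\<in>topspace L_topology. h l' \<in> V \<longrightarrow> l' \<in> W)"
      using W
    proof
      assume "W \<in> {{l \<in> L_space. (INF K\<in>U. l K) < ereal t} | U t. open U}"
      then obtain U t where U: "open U" and WU: "W = {l \<in> L_space. (INF K\<in>U. l K) < ereal t}" by blast
      have "(INF K\<in>U. l K) < ereal t" using lW WU by simp
      from below[OF U this] obtain n \<delta> where n: "h l n < \<delta>"
        "\<And>l'. l' \<in> L_space \<Longrightarrow> h l' n < \<delta> \<Longrightarrow> (INF P\<in>U. l' P) < ereal t" by blast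
      have "open {z :: nat \<Rightarrow> real. z n < \<delta>}"
        by (intro open_Collect_less continuous_on_product_coordinates continuous_on_const)
      then show ?thesis
        using n WU by (intro exI[of _ "{z. z n < \<delta>}"]) (auto simp: topspace_L_topology_eq)
    next
      assume "W \<in> {{l \<in> L_space. (INF K\<in>C. l K) > ereal t} | C t. compact C}"
      then obtain C t where C: "compact C" and WC: "W = {l \<in> L_space. (INF K\<in>C. l K) > ereal t}" by blast
      have l: "l \<in> L_space" and "ereal t < (INF K\<in>C. l K)" using lW WC by auto
      then obtain s where s: "ereal t < ereal s" "ereal s < (INF K\<in>C. l K)" using ereal_dense2 by blast
      have "ereal s < l K" if "K \<in> C" for K using s(2) INF_lower[OF that, of l] by (rule less_le_trans)
      then have "\<forall>K. \<exists>n \<delta> N. K \<in> C \<longrightarrow> open N \<and> K \<in> N \<and> \<delta> < h l n \<and>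
          (\<forall>l'. \<delta> < h l' n \<longrightarrow> (\<forall>P\<in>N. ereal s < l' P))"
        using above[OF l] by meson
      then obtain n \<delta> N where N: "\<And>K. K \<in> C \<Longrightarrow> open (N K) \<and> K \<in> N K \<and> \<delta> K < h l (n K) \<and>
          (\<forall>l'. \<delta> K < h l' (n K) \<longrightarrow> (\<forall>P\<in>N K. ereal s < l' P))" by metis
      obtain C' where C': "C' \<subseteq> C" "finite C'" "C \<subseteq> (\<Union>K\<in>C'. N K)"
        by (rule compactE_image[OF C, of C N]) (use N in auto)
      define V where "V = (\<Inter>K\<in>C'. {z :: nat \<Rightarrow> real. \<delta> K < z (n K)})"
      have "open V"
        unfolding V_def
        by (intro open_INT C' ballI open_Collect_less continuous_on_product_coordinates continuous_on_const)
      moreover have "h l \<in> V" using N C' by (auto simp: V_def)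
      moreover have "l' \<in> W" if l': "l' \<in> topspace L_topology" "h l' \<in> V" for l'
      proof -
        have "ereal s \<le> l' P" if P: "P \<in> C" for P
        proof -
          obtain K where "K \<in> C'" "P \<in> N K" using C'(3) P by blast
          then show ?thesis using N[of K] C'(1) l'(2) by (auto simp: V_def intro!: less_imp_le)
        qed
        then have "ereal s \<le> (INF P\<in>C. l' P)" by (intro INF_greatest)
        with s(1) have "ereal t < (INF P\<in>C. l' P)" by (rule less_le_trans)
        with l'(1) show ?thesis by (simp add: WC topspace_L_topology_eq)
      qed
      ultimately show ?thesis by (intro exI[of _ V]) auto
    qed
  qed
qed

text \<open>All the sets \<open>K \<union> {x}\<close> have values at most \<open>l K\<close> and so lie in one compact family of compact sets,
  whose union is compact and contains every \<open>x\<close>.\<close>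
lemma equicoercive_imp_compact_UNIV:
  fixes l :: "'a::metric_space compacts \<Rightarrow> ereal"
  assumes E: "equicoercive E" and l: "l \<in> E" "l \<in> L_space" and K: "l K \<noteq> \<infinity>"
  shows "compact (UNIV :: 'a set)"
proof -
  obtain r0 :: real where r0: "l K < ereal r0" using K unfolding less_PInf_Ex_of_nat by blast
  define r where "r = max 1 r0"
  have r: "0 < r" "l K < ereal r" using r0 by (auto simp: r_def intro: less_le_trans)
  define C where "C = closure (\<Union>l\<in>E. {K. l K \<le> ereal r})"
  have C: "compact C" using E r by (simp add: C_def equicoercive_def)
  have "x \<in> (\<Union>K\<in>C. carrier_of K)" for x
  proof -
    define K' where "K' = Compacts (insert x (carrier_of K))"
    have K': "carrier_of K' = insert x (carrier_of K)" by (simp add: K'_def compact_insert)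
    have "l K' \<le> l K" using K' by (intro L_space_antimono l) auto
    then have "l K' \<le> ereal r" using r by simp
    then have "K' \<in> (\<Union>l\<in>E. {K. l K \<le> ereal r})" by (intro UN_I[OF l(1)]) simp
    then have "K' \<in> C" unfolding C_def by (rule subsetD[OF closure_subset])
    then show ?thesis by (rule UN_I) (simp add: K')
  qed
  then have "(\<Union>K\<in>C. carrier_of K) = UNIV" by auto
  then show ?thesis using compact_Union_carrier[OF C] by simp
qed

text \<open>If the space is not compact, only the constant function \<open>\<infinity>\<close> can belong to \<open>E\<close>.\<close>
theorem metrizable_equicoercive:
  fixes E :: "('a::polish_space compacts \<Rightarrow> ereal) set"
  assumes E: "equicoercive E"
  shows "metrizable_space (subtopology L_topology E)"
proof (cases "\<exists>l\<in>E \<inter> L_space. \<exists>K. l K \<noteq> \<infinity>")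
  case True
  then have "compact (UNIV :: 'a set)" using equicoercive_imp_compact_UNIV[OF E] by blast
  then show ?thesis by (intro metrizable_space_subtopology metrizable_L_topology)
next
  case False
  let ?X = "subtopology L_topology E"
  have "topspace ?X \<subseteq> {\<lambda>_. \<infinity>}" using False by (auto simp: topspace_L_topology_eq)
  then have "topspace ?X = {} \<or> topspace ?X = {\<lambda>_. \<infinity>}" by blast
  then have "?X = discrete_topology {} \<or> ?X = discrete_topology {\<lambda>_. \<infinity>}"
    unfolding subtopology_eq_discrete_topology_empty subtopology_eq_discrete_topology_sing .
  then show ?thesis using metrizable_space_discrete_topology by metis
qed

section \<open>Convergence and metrizability in the space of measures and rate functions\<close>

lemma limitin_W_imp_L:
  "limitin W_topology w l F \<Longrightarrow> limitin L_topology w l F"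
  by (simp add: W_topology_def limitin_subtopology)

theorem theorem5p1:
  shows "(\<forall>(w :: nat \<Rightarrow> 'a::polish_space compacts \<Rightarrow> ereal) w_lim.
      (\<forall>n. w n \<in> W_space) \<and> w_lim \<in> W_space \<and> limitin W_topology w w_lim sequentially \<longrightarrow>
        (\<forall>a \<mu>. (\<forall>n. 0 < a n \<and> \<mu> n \<in> prob_measures \<and> w n = l_meas (a n) (\<mu> n)) \<and>
            bounded (range a) \<and> (INF K. w_lim K) = 0 \<longrightarrow>
          (\<exists>a_lim \<mu>_lim. 0 < a_lim \<and> \<mu>_lim \<in> prob_measures \<and> w_lim = l_meas a_lim \<mu>_lim \<and>
             limitin narrow_topology \<mu> \<mu>_lim sequentially \<and>
             (a \<longlonglongrightarrow> a_lim \<or> (\<exists>x. \<mu>_lim = return borel x)))) \<and>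
        (\<forall>a \<mu>. (\<forall>n. 0 < a n \<and> \<mu> n \<in> prob_measures \<and> w n = l_meas (a n) (\<mu> n)) \<and>
            filterlim a at_top sequentially \<longrightarrow>
          (\<exists>I \<in> rate_functions. w_lim = l_rate I \<and> weak_LDP a \<mu> I)) \<and>
        (\<forall>J. (\<forall>n. J n \<in> rate_functions \<and> w n = l_rate (J n)) \<longrightarrow>
          (\<exists>I \<in> rate_functions. w_lim = l_rate I \<and> gamma_converges J I)))
    \<and> (\<forall>E :: ('a compacts \<Rightarrow> ereal) set. E \<subseteq> W_space \<and> equicoercive E \<longrightarrow>
        metrizable_space (subtopology W_topology E))"
proof (intro conjI allI impI; (elim conjE)?)
  fix w :: "nat \<Rightarrow> 'a compacts \<Rightarrow> ereal" and w_lim a \<mu>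
  assume "w_lim \<in> W_space" and lim: "limitin W_topology w w_lim sequentially"
    and w: "\<forall>n. 0 < a n \<and> \<mu> n \<in> prob_measures \<and> w n = l_meas (a n) (\<mu> n)"
    and "bounded (range a)" "(INF K. w_lim K) = 0"
  then show "\<exists>a_lim \<mu>_lim. 0 < a_lim \<and> \<mu>_lim \<in> prob_measures \<and> w_lim = l_meas a_lim \<mu>_lim \<and>
      limitin narrow_topology \<mu> \<mu>_lim sequentially \<and> (a \<longlonglongrightarrow> a_lim \<or> (\<exists>x. \<mu>_lim = return borel x))"
    by (intro bounded_speed_limit[OF limitin_W_imp_L[OF lim]]) auto
next
  fix w :: "nat \<Rightarrow> 'a compacts \<Rightarrow> ereal" and w_lim a \<mu>
  assume "w_lim \<in> W_space" and lim: "limitin W_topology w w_lim sequentially"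
    and w: "\<forall>n. 0 < a n \<and> \<mu> n \<in> prob_measures \<and> w n = l_meas (a n) (\<mu> n)"
    and "filterlim a at_top sequentially"
  then show "\<exists>I \<in> rate_functions. w_lim = l_rate I \<and> weak_LDP a \<mu> I"
    by (intro weak_LDP_of_limit[OF limitin_W_imp_L[OF lim]] W_space_empty) auto
next
  fix w :: "nat \<Rightarrow> 'a compacts \<Rightarrow> ereal" and w_lim J
  assume "w_lim \<in> W_space" and lim: "limitin W_topology w w_lim sequentially"
    and "\<forall>n. J n \<in> rate_functions \<and> w n = l_rate (J n)"
  then show "\<exists>I \<in> rate_functions. w_lim = l_rate I \<and> gamma_converges J I"
    by (intro gamma_converges_of_limit[OF limitin_W_imp_L[OF lim]] W_space_empty) auto
next
  fix E :: "('a compacts \<Rightarrow> ereal) set"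
  assume "equicoercive E"
  then have "metrizable_space (subtopology (subtopology L_topology E) W_space)"
    by (intro metrizable_space_subtopology metrizable_equicoercive)
  then show "metrizable_space (subtopology W_topology E)"
    by (simp add: W_topology_def subtopology_subtopology Int_commute)
qed

end
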